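(* Let $\alpha\in(0,1)$, let $D\subset\mathbb{R}^d$ be open with $0\in D$, and let $f:D\to\mathbb{R}^d$ satisfy $f(0)=0$ and be locally Lipschitz continuous in a neighborhood of the origin. Consider the fractional system \[ {}^{C}D^\alpha_{0+}x(t)=f(x(t)),\quad t>0. \tag{$*$} \] Assume there is a function $V:\mathbb{R}^d\to\mathbb{R}_+$ such that (V.i) $V$ is convex and differentiable on $\mathbb{R}^d$; (V.ii) there exist constants $a,b,C_1,C_2,r>0$ with $B_r(0)\subset D$ such that $C_1\|x\|^a\le V(x)\le C_2\|x\|^b$ for all $x\in B_r(0)$; (V.iii) there are constants $C_3\ge 0$ and $c\ge b$ such that $\langle\nabla V(x),f(x)\rangle\le -C_3\|x\|^c$ for all $x\in B_r(0)$. Then: (a) if $C_3=0$, the trivial solution of $( * )$ is stable; (b) if $C_3>0$ (and $c\ge b$), the trivial solution of $( * )$ is asymptotically stable.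
   Context: Riemann--Liouville integral: $I^\alpha_{0+}x(t)=\frac{1}{\Gamma(\alpha)}\int_0^t(t-\tau)^{\alpha-1}x(\tau)\,d\tau$; Caputo derivative: ${}^{C}D^\alpha_{0+}x(t)=\frac{d}{dt}I^{1-\alpha}_{0+}(x-x(0))(t)$, componentwise for vector functions. A solution of $( * )$ with $x(0)=x_0$ on $[0,T)$ is a continuous function $x$ with values in $D$ satisfying ${}^{C}D^\alpha_{0+}x=f(x)$ there (equivalently $x(t)=x_0+I^\alpha_{0+}(f\circ x)(t)$). For $x_0$ near $0$ the initial value problem has a unique solution $\varphi(\cdot,x_0)$ on a maximal interval $[0,t_{\max}(x_0))$, $0<t_{\max}(x_0)\le\infty$. $B_r(0)$ denotes the closed ball of radius $r$ centered at $0$ in $\mathbb{R}^d$ with the Euclidean norm $\|\cdot\|$. The trivial solution is stable if for every $\varepsilon>0$ there is $\delta>0$ such that $\|x_0\|<\delta$ implies $t_{\max}(x_0)=\infty$ and $\|\varphi(t,x_0)\|<\varepsilon$ for all $t\ge0$; it is asymptotically stable if it is stable and there is $\hat\delta>0$ such that $\lim_{t\to\infty}\varphi(t,x_0)=0$ whenever $\|x_0\|<\hat\delta$. *)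

theory Defs
  imports "HOL-Analysis.Analysis"
begin

definition RL_int :: "real \<Rightarrow> (real \<Rightarrow> 'a::euclidean_space) \<Rightarrow> real \<Rightarrow> 'a" where
  "RL_int \<alpha> x t = (1 / Gamma \<alpha>) *\<^sub>R integral {0..t} (\<lambda>\<tau>. (t - \<tau>) powr (\<alpha> - 1) *\<^sub>R x \<tau>)"

definition caputo :: "real \<Rightarrow> (real \<Rightarrow> 'a::euclidean_space) \<Rightarrow> real \<Rightarrow> 'a" where
  "caputo \<alpha> x t = vector_derivative (\<lambda>s. RL_int (1 - \<alpha>) (\<lambda>\<tau>. x \<tau> - x 0) s) (at t)"

definition is_solution :: "real \<Rightarrow> 'a::euclidean_space set \<Rightarrow> ('a \<Rightarrow> 'a) \<Rightarrow> ereal \<Rightarrow> (real \<Rightarrow> 'a) \<Rightarrow> bool" where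
  "is_solution \<alpha> D f T x \<longleftrightarrow>
     continuous_on {t. 0 \<le> t \<and> ereal t < T} x \<and>
     (\<forall>t. 0 \<le> t \<and> ereal t < T \<longrightarrow> x t \<in> D) \<and>
     (\<forall>t. 0 < t \<and> ereal t < T \<longrightarrow>
        (\<lambda>s. RL_int (1 - \<alpha>) (\<lambda>\<tau>. x \<tau> - x 0) s) differentiable (at t) \<and>
        caputo \<alpha> x t = f (x t))"

definition frac_stable :: "real \<Rightarrow> 'a::euclidean_space set \<Rightarrow> ('a \<Rightarrow> 'a) \<Rightarrow> bool" where
  "frac_stable \<alpha> D f \<longleftrightarrow>
     (\<forall>\<epsilon>>0. \<exists>\<delta>>0. \<forall>x0. norm x0 < \<delta> \<longrightarrow>
        (\<exists>x. is_solution \<alpha> D f \<infinity> x \<and> x 0 = x0) \<and>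
        (\<forall>T x. is_solution \<alpha> D f T x \<and> x 0 = x0 \<longrightarrow>
            (\<forall>t. 0 \<le> t \<and> ereal t < T \<longrightarrow> norm (x t) < \<epsilon>)))"

definition frac_asymp_stable :: "real \<Rightarrow> 'a::euclidean_space set \<Rightarrow> ('a \<Rightarrow> 'a) \<Rightarrow> bool" where
  "frac_asymp_stable \<alpha> D f \<longleftrightarrow>
     frac_stable \<alpha> D f \<and>
     (\<exists>\<delta>>0. \<forall>x0. norm x0 < \<delta> \<longrightarrow>
        (\<exists>x. is_solution \<alpha> D f \<infinity> x \<and> x 0 = x0) \<and>
        (\<forall>x. is_solution \<alpha> D f \<infinity> x \<and> x 0 = x0 \<longrightarrow> (x \<longlongrightarrow> 0) at_top))"

definition grad :: "('a::euclidean_space \<Rightarrow> real) \<Rightarrow> 'a \<Rightarrow> 'a" where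
  "grad V x = (\<Sum>i\<in>Basis. frechet_derivative V (at x) i *\<^sub>R i)"

end

theory Submission
  imports Defs
begin

text \<open>
  A solution satisfies \<open>x = x 0 + I\<^sup>\<alpha> h\<close> with \<open>h = f \<circ> x\<close>, so for any fixed vector \<open>p\<close> the scalar function
  \<open>\<langle>p, x\<rangle>\<close> is a constant plus \<open>I\<^sup>\<alpha> \<langle>p, h\<rangle>\<close>. If a function \<open>q = q\<^sub>0 + I\<^sup>\<alpha> k\<close> attains its maximum over \<open>{0..t}\<close>
  at \<open>t\<close>, then \<open>k t \<ge> (q t - q\<^sub>0) * t powr - \<alpha> / \<Gamma>(1 - \<alpha>)\<close>; the proof compares the difference quotients of
  \<open>I\<^bsup>1-\<alpha>\<^esup> (q - q\<^sub>0)\<close> from the left and uses that \<open>q t - q s = o((t - s) powr \<alpha>)\<close>.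

  To bound \<open>V (x t)\<close> by a function \<open>y\<close>, look at a positive maximum \<open>t\<close> of \<open>V \<circ> x - y\<close> and put
  \<open>p = grad V (x t)\<close>. By convexity \<open>q = \<langle>p, x\<rangle> - y\<close> is also maximal at \<open>t\<close>, and the maximum principle forces
  \<open>\<langle>grad V (x t), f (x t)\<rangle>\<close> to exceed the Caputo derivative of \<open>y\<close>. No fractional derivative of \<open>V \<circ> x\<close> is
  ever taken. A constant \<open>y\<close> gives stability. For asymptotic stability take \<open>y t = e + V (x 0) * exp (- \<eta> * t)\<close>:
  as \<open>\<eta> \<rightarrow> 0\<close> its Caputo derivative tends to \<open>0\<close> uniformly in \<open>t\<close>, whereas
  \<open>\<langle>grad V z, f z\<rangle>\<close> stays below a negative constant on the part of the ball where \<open>V z \<ge> e\<close>.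

  Global solutions come from Banach's fixed point theorem, in a norm weighted by \<open>exp (- \<mu> * t)\<close>, for \<open>f\<close> composed
  with the projection onto a small ball; the bound on \<open>V\<close> keeps them inside that ball.
\<close>

section \<open>Abel integrals\<close>

text \<open>The Riemann-Liouville integral without its factor \<open>1 / Gamma \<beta>\<close>;
  estimates of the singular kernel stay free of Gamma values, which return through
  \<open>RL_int_eq_abel_int\<close>.\<close>

definition abel_int :: "real \<Rightarrow> (real \<Rightarrow> 'a::euclidean_space) \<Rightarrow> real \<Rightarrow> 'a" where
  "abel_int \<beta> k t = integral {0..t} (\<lambda>s. (t - s) powr (\<beta> - 1) *\<^sub>R k s)"

lemma RL_int_eq_abel_int: "RL_int \<beta> k t = (1 / Gamma \<beta>) *\<^sub>R abel_int \<beta> k t"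
  by (simp add: RL_int_def abel_int_def)

text \<open>For \<open>b = t\<close> the integrand is singular at the right end, but its
  antiderivative is continuous there, so the fundamental theorem with derivatives only in the
  interior applies.\<close>

lemma abel_kernel_has_integral:
  fixes \<beta> :: real
  assumes "0 < \<beta>" "a \<le> b" "b \<le> t"
  shows "((\<lambda>s. (t - s) powr (\<beta> - 1)) has_integral ((t - a) powr \<beta> - (t - b) powr \<beta>) / \<beta>) {a..b}"
proof -
  have "((\<lambda>s. (t - s) powr (\<beta> - 1)) has_integral
      (- ((t - b) powr \<beta> / \<beta>) - - ((t - a) powr \<beta> / \<beta>))) {a..b}"
  proof (rule fundamental_theorem_of_calculus_interior[OF \<open>a \<le> b\<close>])
    show "continuous_on {a..b} (\<lambda>s. - ((t - s) powr \<beta> / \<beta>))"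
      using assms by (auto intro!: continuous_intros continuous_on_powr')
    fix s assume s: "s \<in> {a<..<b}"
    then have "t - s > 0" using assms by auto
    then have "((\<lambda>s. - ((t - s) powr \<beta> / \<beta>)) has_real_derivative (t - s) powr (\<beta> - 1)) (at s)"
      using assms by (auto intro!: derivative_eq_intros)
    then show "((\<lambda>s. - ((t - s) powr \<beta> / \<beta>)) has_vector_derivative (t - s) powr (\<beta> - 1)) (at s)"
      by (simp add: has_real_derivative_iff_has_vector_derivative)
  qed
  then show ?thesis by (simp add: diff_divide_distrib)
qed

lemma abel_kernel_absolutely_integrable:
  fixes k :: "real \<Rightarrow> 'a::euclidean_space"
  assumes "0 < \<beta>" "b \<le> t" "continuous_on {a..b} k"
  shows "(\<lambda>s. (t - s) powr (\<beta> - 1) *\<^sub>R k s) absolutely_integrable_on {a..b}"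
proof (cases "a \<le> b")
  case True
  have "(\<lambda>s. (t - s) powr (\<beta> - 1)) absolutely_integrable_on {a..b}"
    using abel_kernel_has_integral[OF assms(1) True assms(2)]
    by (intro nonnegative_absolutely_integrable_1) (auto simp: integrable_on_def)
  moreover have "bilinear (\<lambda>(x::'a) (r::real). r *\<^sub>R x)"
    by (simp add: bilinear_def linear_iff algebra_simps)
  moreover have "k \<in> borel_measurable (lebesgue_on {a..b})"
    using assms by (intro continuous_imp_measurable_on_sets_lebesgue) auto
  moreover have "bounded (k ` {a..b})"
    using assms by (intro compact_imp_bounded compact_continuous_image) auto
  ultimately show ?thesis
    using absolutely_integrable_bounded_measurable_product[of "\<lambda>(x::'a) (r::real). r *\<^sub>R x" k "{a..b}"]
    by auto
qed auto

lemma abel_kernel_integrable: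
  fixes k :: "real \<Rightarrow> 'a::euclidean_space"
  assumes "0 < \<beta>" "b \<le> t" "continuous_on {a..b} k"
  shows "(\<lambda>s. (t - s) powr (\<beta> - 1) *\<^sub>R k s) integrable_on {a..b}"
  using abel_kernel_absolutely_integrable[OF assms] absolutely_integrable_on_def by blast

lemma abel_int_cong:
  assumes "\<And>s. s \<in> {0..t} \<Longrightarrow> k s = k' s"
  shows "abel_int \<beta> k t = abel_int \<beta> k' t"
  unfolding abel_int_def by (intro integral_cong) (simp add: assms)

lemma abel_int_diff:
  assumes "0 < \<beta>" "continuous_on {0..t} k" "continuous_on {0..t} k'"
  shows "abel_int \<beta> (\<lambda>s. k s - k' s) t = abel_int \<beta> k t - abel_int \<beta> k' t"
  unfolding abel_int_def scaleR_diff_right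
  by (intro integral_diff abel_kernel_integrable assms) auto

lemma abel_int_scaleR: "abel_int \<beta> (\<lambda>s. c *\<^sub>R k s) t = c *\<^sub>R abel_int \<beta> k t"
  unfolding abel_int_def by (simp flip: integral_cmul add: mult.commute)

lemma abel_int_inner:
  assumes "0 < \<beta>" "continuous_on {0..t} k"
  shows "abel_int \<beta> (\<lambda>s. p \<bullet> k s) t = p \<bullet> abel_int \<beta> k t"
proof -
  have "integral {0..t} ((\<bullet>) p \<circ> (\<lambda>s. (t - s) powr (\<beta> - 1) *\<^sub>R k s))
      = p \<bullet> integral {0..t} (\<lambda>s. (t - s) powr (\<beta> - 1) *\<^sub>R k s)"
    by (intro integral_linear abel_kernel_integrable assms bounded_linear_inner_right) auto
  then show ?thesis by (simp add: abel_int_def o_def)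
qed

text \<open>Subadditivity of a concave power. After division by \<open>y powr \<beta>\<close> it
  follows from \<open>w \<le> w powr \<beta>\<close> on the unit interval, applied to
  \<open>u\<close> and to \<open>1 - u\<close>.\<close>

lemma powr_diff_le_powr:
  fixes x y \<beta> :: real
  assumes "0 \<le> x" "x \<le> y" "0 < \<beta>" "\<beta> < 1"
  shows "y powr \<beta> - x powr \<beta> \<le> (y - x) powr \<beta>"
proof (cases "y = 0")
  case True then show ?thesis using assms by simp
next
  case False
  then have y: "y > 0" using assms by simp
  define u where "u = x / y"
  have u: "0 \<le> u" "u \<le> 1" using assms y by (auto simp: u_def)
  have ge: "w \<le> w powr \<beta>" if "0 \<le> w" "w \<le> 1" for w :: real
    using powr_mono'[of \<beta> 1 w] that assms by simp
  have "1 \<le> u powr \<beta> + (1 - u) powr \<beta>"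
    using ge[of u] ge[of "1 - u"] u by simp
  then have "y powr \<beta> * 1 \<le> y powr \<beta> * (u powr \<beta> + (1 - u) powr \<beta>)"
    by (intro mult_left_mono) auto
  also have "\<dots> = (y * u) powr \<beta> + (y * (1 - u)) powr \<beta>"
    using u y by (subst (1 2) powr_mult) (auto simp: distrib_left)
  also have "y * u = x" using y by (simp add: u_def)
  also have "y * (1 - u) = y - x" using y by (simp add: u_def field_simps)
  finally show ?thesis by simp
qed

section \<open>Increments and continuity of Abel integrals\<close>

lemma norm_integral_weighted_le:
  fixes k :: "real \<Rightarrow> 'a::euclidean_space"
  assumes w: "(w has_integral I) S" and "(\<lambda>s. w s *\<^sub>R k s) integrable_on S"
    and "\<And>s. s \<in> S \<Longrightarrow> 0 \<le> w s" "\<And>s. s \<in> S \<Longrightarrow> norm (k s) \<le> M"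
  shows "norm (integral S (\<lambda>s. w s *\<^sub>R k s)) \<le> M * I"
proof -
  have I: "((\<lambda>s. M * w s) has_integral M * I) S"
    using w by (rule has_integral_mult_right)
  have "norm (integral S (\<lambda>s. w s *\<^sub>R k s)) \<le> integral S (\<lambda>s. M * w s)"
    using assms I
    by (intro integral_norm_bound_integral) (auto simp: mult.commute[of M] intro!: mult_left_mono)
  then show ?thesis unfolding integral_unique[OF I] .
qed

lemma abel_int_split:
  assumes "0 < \<beta>" "0 \<le> d" "d \<le> t" "continuous_on {0..t} k"
  shows "abel_int \<beta> k t = integral {0..d} (\<lambda>s. (t - s) powr (\<beta> - 1) *\<^sub>R k s)
      + integral {d..t} (\<lambda>s. (t - s) powr (\<beta> - 1) *\<^sub>R k s)"
  unfolding abel_int_def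
  by (rule sym, rule Henstock_Kurzweil_Integration.integral_combine)
     (use assms in \<open>auto intro!: abel_kernel_integrable\<close>)

text \<open>With \<open>d = 0\<close> this is Hoelder continuity; with \<open>d\<close> close to \<open>t\<close> the coefficient \<open>\<epsilon>\<close> of
  \<open>(t - t') powr \<beta>\<close> only sees the values of \<open>k\<close> near \<open>t\<close>, and the other term is \<open>O(t - t')\<close>.\<close>

lemma abel_int_diff_bound:
  fixes k :: "real \<Rightarrow> 'a::euclidean_space"
  assumes \<beta>: "0 < \<beta>" "\<beta> < 1" and t: "0 \<le> d" "d \<le> t'" "t' \<le> t"
    and k: "continuous_on {0..t} k"
    and M: "\<And>s. s \<in> {0..d} \<Longrightarrow> norm (k s) \<le> M"
    and \<epsilon>: "\<And>s. s \<in> {d..t} \<Longrightarrow> norm (k s) \<le> \<epsilon>"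
  shows "norm (abel_int \<beta> k t - abel_int \<beta> k t')
    \<le> 2 * \<epsilon> * (t - t') powr \<beta> / \<beta> + M * ((t - d) powr \<beta> - (t' - d) powr \<beta>) / \<beta>"
proof -
  define K where "K u s = (u - s) powr (\<beta> - 1) *\<^sub>R k s" for u s
  \<comment> \<open>The difference of the two kernels on their common domain. It is nonnegative for
    \<open>s < t'\<close> because the exponent \<open>\<beta> - 1\<close> is negative, so its
    integral can be computed without absolute values.\<close>
  define W where "W s = (t' - s) powr (\<beta> - 1) - (t - s) powr (\<beta> - 1)" for s
  have M0: "0 \<le> M" using order_trans[OF norm_ge_zero M[of 0]] t by simp
  have \<epsilon>0: "0 \<le> \<epsilon>" using order_trans[OF norm_ge_zero \<epsilon>[of d]] t by simp
  have cont: "continuous_on {u..v} k" if "0 \<le> u" "v \<le> t" for u v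
    using k that by (auto intro: continuous_on_subset)
  have W: "(W has_integral ((t' - u) powr \<beta> - (t' - v) powr \<beta>) / \<beta>
      - ((t - u) powr \<beta> - (t - v) powr \<beta>) / \<beta>) {u..v}" if "0 \<le> u" "u \<le> v" "v \<le> t'" for u v
    unfolding W_def by (intro has_integral_diff abel_kernel_has_integral) (use that \<beta> t in auto)
  have Wk: "integral {u..v} (K t') = integral {u..v} (K t) + integral {u..v} (\<lambda>s. W s *\<^sub>R k s)"
    and Wi: "(\<lambda>s. W s *\<^sub>R k s) integrable_on {u..v}"
    if "0 \<le> u" "u \<le> v" "v \<le> t'" for u v
  proof -
    have i: "K t integrable_on {u..v}" "K t' integrable_on {u..v}"
      unfolding K_def by (intro abel_kernel_integrable cont; use that \<beta> t in simp)+
    have e: "(\<lambda>s. W s *\<^sub>R k s) = (\<lambda>s. K t' s - K t s)"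
      by (simp add: W_def K_def scaleR_diff_left)
    show "(\<lambda>s. W s *\<^sub>R k s) integrable_on {u..v}"
      unfolding e using i by (intro integrable_diff)
    show "integral {u..v} (K t') = integral {u..v} (K t) + integral {u..v} (\<lambda>s. W s *\<^sub>R k s)"
      unfolding e using i by (simp add: integral_diff)
  qed
  have W0: "0 \<le> W s" if "s < t'" for s
    using that t \<beta> powr_mono2'[of "\<beta> - 1" "t' - s" "t - s"] by (simp add: W_def)
  have bd: "norm (integral {u..v} (\<lambda>s. W s *\<^sub>R k s)) \<le> N *
      (((t' - u) powr \<beta> - (t' - v) powr \<beta>) / \<beta> - ((t - u) powr \<beta> - (t - v) powr \<beta>) / \<beta>)"
    if uv: "0 \<le> u" "u \<le> v" "v \<le> t'" and N: "\<And>s. s \<in> {u..v} \<Longrightarrow> norm (k s) \<le> N" for u v N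
  proof -
    \<comment> \<open>The right end point is removed because
      \<open>0 powr (\<beta> - 1) = 0\<close>: for \<open>v = t' < t\<close> the difference
      \<open>W v\<close> is negative.\<close>
    have n: "negligible {v}" by simp
    have "norm (integral ({u..v} - {v}) (\<lambda>s. W s *\<^sub>R k s)) \<le> N *
      (((t' - u) powr \<beta> - (t' - v) powr \<beta>) / \<beta> - ((t - u) powr \<beta> - (t - v) powr \<beta>) / \<beta>)"
    proof (rule norm_integral_weighted_le)
      show "(W has_integral ((t' - u) powr \<beta> - (t' - v) powr \<beta>) / \<beta>
        - ((t - u) powr \<beta> - (t - v) powr \<beta>) / \<beta>) ({u..v} - {v})"
        using W[OF uv]
        by (subst has_integral_spike_set_eq[where T = "{u..v}"]) (auto intro: negligible_subset[OF n])
      show "(\<lambda>s. W s *\<^sub>R k s) integrable_on {u..v} - {v}"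
        using Wi[OF uv] by (rule integrable_spike_set) (auto intro: negligible_subset[OF n])
    qed (use uv N W0 in auto)
    moreover have "integral ({u..v} - {v}) (\<lambda>s. W s *\<^sub>R k s) = integral {u..v} (\<lambda>s. W s *\<^sub>R k s)"
      by (rule integral_spike_set) (auto intro: negligible_subset[OF n])
    ultimately show ?thesis by simp
  qed
  have "abel_int \<beta> k t = integral {0..d} (K t) + integral {d..t'} (K t) + integral {t'..t} (K t)"
    using abel_int_split[of \<beta> t' t k] t \<beta> k
      Henstock_Kurzweil_Integration.integral_combine[of 0 d t' "K t"]
      abel_kernel_integrable[of \<beta> t' t 0 k] cont
    by (simp add: K_def[abs_def])
  moreover have "abel_int \<beta> k t' = integral {0..d} (K t') + integral {d..t'} (K t')"
    using abel_int_split[of \<beta> d t' k] t \<beta> cont by (simp add: K_def[abs_def])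
  moreover note Wk[of 0 d] Wk[of d t']
  ultimately have "abel_int \<beta> k t - abel_int \<beta> k t'
    = - integral {0..d} (\<lambda>s. W s *\<^sub>R k s) - integral {d..t'} (\<lambda>s. W s *\<^sub>R k s) + integral {t'..t} (K t)"
    using t by simp
  moreover have tri: "norm (- A - B + C) \<le> norm A + norm B + norm C" for A B C :: 'a
    using norm_triangle_ineq[of "- A - B" C] norm_triangle_ineq4[of "- A" B] by simp
  ultimately have "norm (abel_int \<beta> k t - abel_int \<beta> k t') \<le> norm (integral {0..d} (\<lambda>s. W s *\<^sub>R k s))
      + norm (integral {d..t'} (\<lambda>s. W s *\<^sub>R k s)) + norm (integral {t'..t} (K t))"
    by (simp only: tri)
  also have "norm (integral {0..d} (\<lambda>s. W s *\<^sub>R k s)) \<le> M * ((t - d) powr \<beta> - (t' - d) powr \<beta>) / \<beta>"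
  proof -
    have "t' powr \<beta> \<le> t powr \<beta>" using t \<beta> by (intro powr_mono2) auto
    then have "((t' - 0) powr \<beta> - (t' - d) powr \<beta>) / \<beta> - ((t - 0) powr \<beta> - (t - d) powr \<beta>) / \<beta>
      \<le> ((t - d) powr \<beta> - (t' - d) powr \<beta>) / \<beta>"
      using \<beta> by (simp add: divide_simps)
    from mult_left_mono[OF this M0] show ?thesis
      using bd[of 0 d M] t M by auto
  qed
  also have "norm (integral {d..t'} (\<lambda>s. W s *\<^sub>R k s)) \<le> \<epsilon> * (t - t') powr \<beta> / \<beta>"
  proof -
    have "(t' - d) powr \<beta> \<le> (t - d) powr \<beta>" using t \<beta> by (intro powr_mono2) auto
    then have "((t' - d) powr \<beta> - (t' - t') powr \<beta>) / \<beta> - ((t - d) powr \<beta> - (t - t') powr \<beta>) / \<beta>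
      \<le> (t - t') powr \<beta> / \<beta>"
      using \<beta> by (simp add: divide_simps)
    from mult_left_mono[OF this \<epsilon>0] show ?thesis
      using bd[of d t' \<epsilon>] t \<epsilon> by auto
  qed
  also have "norm (integral {t'..t} (K t)) \<le> \<epsilon> * (t - t') powr \<beta> / \<beta>"
  proof -
    have "norm (integral {t'..t} (K t)) \<le> \<epsilon> * (((t - t') powr \<beta> - (t - t) powr \<beta>) / \<beta>)"
      unfolding K_def
      by (intro norm_integral_weighted_le abel_kernel_has_integral abel_kernel_integrable cont)
         (use t \<beta> \<epsilon> in auto)
    then show ?thesis by simp
  qed
  finally show ?thesis by (simp add: algebra_simps)
qed

text \<open>A bound \<open>M\<close> on \<open>k\<close> gives Hoelder continuity with exponent
  \<open>\<beta>\<close> and constant \<open>3 * M / \<beta>\<close>: take \<open>d = 0\<close> in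
  \<open>abel_int_diff_bound\<close> and apply subadditivity of the power.\<close>

lemma continuous_on_abel_int:
  fixes k :: "real \<Rightarrow> 'a::euclidean_space"
  assumes \<beta>: "0 < \<beta>" "\<beta> < 1" and k: "continuous_on {0..T} k"
  shows "continuous_on {0..T} (abel_int \<beta> k)"
proof -
  have "bounded (k ` {0..T})"
    using k by (intro compact_imp_bounded compact_continuous_image) auto
  then obtain M where M: "\<And>s. s \<in> {0..T} \<Longrightarrow> norm (k s) \<le> M"
    unfolding bounded_iff by blast
  have le: "norm (abel_int \<beta> k t - abel_int \<beta> k t') \<le> 3 * M / \<beta> * \<bar>t - t'\<bar> powr \<beta>"
    if "t' \<in> {0..T}" "t \<in> {0..T}" "t' \<le> t" for t t'
  proof -
    have M0: "0 \<le> M" using M[of t] that norm_ge_zero[of "k t"] by linarith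
    have "norm (abel_int \<beta> k t - abel_int \<beta> k t')
        \<le> 2 * M * (t - t') powr \<beta> / \<beta> + M * ((t - 0) powr \<beta> - (t' - 0) powr \<beta>) / \<beta>"
      using that by (intro abel_int_diff_bound \<beta> M continuous_on_subset[OF k]) auto
    also have "\<dots> \<le> 2 * M * (t - t') powr \<beta> / \<beta> + M * (t - t') powr \<beta> / \<beta>"
      using powr_diff_le_powr[of t' t \<beta>] that \<beta> M0
      by (intro add_left_mono divide_right_mono mult_left_mono) auto
    also have "\<dots> = 3 * M / \<beta> * \<bar>t - t'\<bar> powr \<beta>" using that by (simp add: field_simps)
    finally show ?thesis .
  qed
  have le': "norm (abel_int \<beta> k t - abel_int \<beta> k t') \<le> 3 * M / \<beta> * \<bar>t - t'\<bar> powr \<beta>"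
    if "t' \<in> {0..T}" "t \<in> {0..T}" for t t'
    using le[of t' t] le[of t t'] that by (cases "t' \<le> t") (auto simp: norm_minus_commute abs_minus_commute)
  show ?thesis
    unfolding continuous_on_def
  proof
    fix t assume t: "t \<in> {0..T}"
    have "((\<lambda>s. 3 * M / \<beta> * \<bar>s - t\<bar> powr \<beta>) \<longlongrightarrow> 3 * M / \<beta> * \<bar>t - t\<bar> powr \<beta>) (at t within {0..T})"
      using \<beta> by (intro tendsto_intros) (auto intro!: eventuallyI)
    then have "((\<lambda>s. 3 * M / \<beta> * \<bar>s - t\<bar> powr \<beta>) \<longlongrightarrow> 0) (at t within {0..T})" by simp
    then have "((\<lambda>s. abel_int \<beta> k s - abel_int \<beta> k t) \<longlongrightarrow> 0) (at t within {0..T})"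
      by (rule Lim_null_comparison[rotated]) (use le' t in \<open>auto simp: eventually_at_filter intro!: eventuallyI\<close>)
    then show "(abel_int \<beta> k \<longlongrightarrow> abel_int \<beta> k t) (at t within {0..T})"
      by (simp add: Lim_null[symmetric])
  qed
qed

section \<open>Composition of fractional integrals of complementary order\<close>

text \<open>Euler's Beta integral under the affine map of \<open>{0..1}\<close> onto
  \<open>{u..t}\<close>. The kernels contribute \<open>m powr (a + b - 2)\<close> and the
  substitution one more factor \<open>m\<close>.\<close>

lemma abel_Beta_has_integral:
  fixes a b :: real
  assumes "0 < a" "0 < b" "u < t"
  shows "((\<lambda>s. (t - s) powr (a - 1) * (s - u) powr (b - 1)) has_integral
    (t - u) powr (a + b - 1) * Beta a b) {u..t}"
proof -
  define m where "m = t - u"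
  have m: "m > 0" using assms by (simp add: m_def)
  have "((\<lambda>x. x powr (b - 1) * (1 - x) powr (a - 1)) has_integral Beta b a) (cbox 0 1)"
    using has_integral_Beta_real[of b a] assms by simp
  from has_integral_affinity[OF this, of "1 / m" "- u / m"] m
  have "((\<lambda>x. ((x - u) / m) powr (b - 1) * (1 - (x - u) / m) powr (a - 1)) has_integral m * Beta b a)
    ((\<lambda>x. m * x + u) ` {0..1})"
    by (simp add: diff_divide_distrib)
  also have "(\<lambda>x. m * x + u) ` {0..1} = {u..t}"
    using m image_affinity_atLeastAtMost[of m u 0 1] by (simp add: m_def)
  finally have "((\<lambda>x. m powr (a + b - 2) * (((x - u) / m) powr (b - 1) * (1 - (x - u) / m) powr (a - 1)))
      has_integral m powr (a + b - 2) * (m * Beta b a)) {u..t}"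
    by (rule has_integral_mult_right)
  moreover have "m powr (a + b - 2) * (((x - u) / m) powr (b - 1) * (1 - (x - u) / m) powr (a - 1))
      = (t - x) powr (a - 1) * (x - u) powr (b - 1)" if "x \<in> {u..t}" for x
  proof -
    have "1 - (x - u) / m = (t - x) / m" using m by (simp add: field_simps m_def)
    moreover have "m powr (a + b - 2) = m powr (a - 1) * m powr (b - 1)"
      by (simp flip: powr_add)
    ultimately show ?thesis using that m by (simp add: powr_divide)
  qed
  moreover have "m powr (a + b - 2) * (m * Beta b a) = (t - u) powr (a + b - 1) * Beta a b"
    using m powr_add[of m "a + b - 2" 1] by (simp add: m_def Beta_commute)
  ultimately show ?thesis
    by (metis (no_types, lifting) has_integral_eq)
qed

text \<open>Carries the gauge integrals of the nonnegative kernels over to Lebesgue integrals, where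
  Fubini's theorem is available.\<close>

lemma integrable_lborel_nonneg_has_integral:
  fixes w :: "real \<Rightarrow> real"
  assumes "w \<in> borel_measurable borel" "\<And>x. 0 \<le> w x" "(w has_integral I) UNIV"
  shows "integrable lborel w" "integral\<^sup>L lborel w = I"
proof -
  have "integral\<^sup>N lborel w = ennreal I"
    by (rule nn_integral_has_integral_lborel[OF assms])
  moreover have "0 \<le> I" using has_integral_nonneg[OF assms(3)] assms(2) by auto
  ultimately have *: "has_bochner_integral lborel w I"
    using assms by (intro has_bochner_integral_nn_integral) auto
  then show "integrable lborel w" "integral\<^sup>L lborel w = I"
    by (auto simp: has_bochner_integral_iff)
qed

text \<open>Fubini on the triangle \<open>0 \<le> u \<le> s \<le> t\<close>. The inner integral over
  \<open>s\<close> is a Beta integral carrying \<open>(t - u) powr (a + b - 1)\<close>, and since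
  \<open>a + b = 1\<close> this power is the constant \<open>1\<close> for
  \<open>u < t\<close>.\<close>

lemma abel_int_abel_int:
  fixes k :: "real \<Rightarrow> 'a::euclidean_space"
  assumes ab: "0 < a" "0 < b" "a + b = 1" and t: "0 \<le> t" and k: "continuous_on {0..t} k"
  shows "abel_int a (abel_int b k) t = Beta a b *\<^sub>R integral {0..t} k"
proof -
  \<comment> \<open>Clamping the argument to \<open>{0..t}\<close> extends \<open>k\<close> to a
    bounded continuous function on the line, as measurability on the whole line demands.\<close>
  define k' where "k' s = k (max 0 (min t s))" for s
  have k'_cont: "continuous_on UNIV k'"
    unfolding k'_def
    by (rule continuous_on_compose2[OF k]) (use t in \<open>auto intro!: continuous_intros\<close>)
  then have [measurable]: "k' \<in> borel_measurable borel"
    by (rule borel_measurable_continuous_onI)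
  have "bounded (k ` {0..t})"
    using k by (intro compact_imp_bounded compact_continuous_image) auto
  then obtain M where M: "\<And>s. s \<in> {0..t} \<Longrightarrow> norm (k s) \<le> M"
    unfolding bounded_iff by blast
  have M': "norm (k' s) \<le> M" for s unfolding k'_def using t by (intro M) auto
  \<comment> \<open>The product of both kernels, cut off to the triangle.\<close>
  define P where "P s u = indicator {0..t} s * indicator {0..s} u *
    ((t - s) powr (a - 1) * (s - u) powr (b - 1))" for s u :: real
  have P0: "0 \<le> P s u" for s u by (simp add: P_def)
  have Pm2[measurable]: "(\<lambda>p. P (fst p) (snd p)) \<in> borel_measurable (borel \<Otimes>\<^sub>M borel)"
    "(\<lambda>p. P (snd p) (fst p)) \<in> borel_measurable (borel \<Otimes>\<^sub>M borel)"
  proof -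
    have "P s u = (if 0 \<le> s \<and> s \<le> t \<and> 0 \<le> u \<and> u \<le> s then (t - s) powr (a - 1) * (s - u) powr (b - 1) else 0)" for s u
      by (auto simp: P_def)
    then show "(\<lambda>p. P (fst p) (snd p)) \<in> borel_measurable (borel \<Otimes>\<^sub>M borel)"
      "(\<lambda>p. P (snd p) (fst p)) \<in> borel_measurable (borel \<Otimes>\<^sub>M borel)" by simp_all
  qed
  have Pm: "P s \<in> borel_measurable borel" "(\<lambda>s. P s u) \<in> borel_measurable borel" for s u
  proof -
    have "(\<lambda>p. P (fst p) (snd p)) \<circ> Pair s \<in> borel_measurable borel"
      "(\<lambda>p. P (fst p) (snd p)) \<circ> (\<lambda>s. (s, u)) \<in> borel_measurable borel"
      by (rule measurable_comp[where N = "borel \<Otimes>\<^sub>M borel"]; measurable)+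
    then show "P s \<in> borel_measurable borel" "(\<lambda>s. P s u) \<in> borel_measurable borel"
      by (simp_all add: o_def)
  qed
  have Pu: "integrable lborel (P s)" "(\<integral>u. P s u \<partial>lborel) = indicator {0..t} s * ((t - s) powr (a - 1) * (s powr b / b))" for s
  proof -
    have "(P s has_integral indicator {0..t} s * ((t - s) powr (a - 1) * (s powr b / b))) UNIV"
    proof (cases "s \<in> {0..t}")
      case True
      have "((\<lambda>u. (t - s) powr (a - 1) * (s - u) powr (b - 1)) has_integral (t - s) powr (a - 1) * (((s - 0) powr b - (s - s) powr b) / b)) {0..s}"
        by (intro has_integral_mult_right abel_kernel_has_integral) (use True ab in auto)
      then have "((\<lambda>u. if u \<in> {0..s} then (t - s) powr (a - 1) * (s - u) powr (b - 1) else 0) has_integral (t - s) powr (a - 1) * (s powr b / b)) UNIV"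
        by (subst has_integral_restrict_UNIV) simp
      moreover have "P s = (\<lambda>u. if u \<in> {0..s} then (t - s) powr (a - 1) * (s - u) powr (b - 1) else 0)"
        using True by (auto simp: P_def)
      ultimately show ?thesis using True by simp
    qed (simp add: P_def[abs_def])
    then show "integrable lborel (P s)" "(\<integral>u. P s u \<partial>lborel) = indicator {0..t} s * ((t - s) powr (a - 1) * (s powr b / b))"
      using integrable_lborel_nonneg_has_integral[of "P s"] P0 Pm by auto
  qed
  have Ps: "integrable lborel (\<lambda>s. P s u)" "(\<integral>s. P s u \<partial>lborel) = indicator {0..<t} u * Beta a b"
    if "u \<noteq> t" for u
  proof -
    have "((\<lambda>s. P s u) has_integral indicator {0..<t} u * Beta a b) UNIV"
    proof (cases "u \<in> {0..<t}")
      case True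
      then have "((\<lambda>s. (t - s) powr (a - 1) * (s - u) powr (b - 1)) has_integral Beta a b) {u..t}"
        using abel_Beta_has_integral[of a b u t] ab by simp
      then have "((\<lambda>s. if s \<in> {u..t} then (t - s) powr (a - 1) * (s - u) powr (b - 1) else 0) has_integral Beta a b) UNIV"
        by (subst has_integral_restrict_UNIV) simp
      moreover have "(\<lambda>s. P s u) = (\<lambda>s. if s \<in> {u..t} then (t - s) powr (a - 1) * (s - u) powr (b - 1) else 0)"
        using True by (auto simp: P_def indicator_def)
      ultimately show ?thesis using True by simp
    next
      case False
      then have "(\<lambda>s. P s u) = (\<lambda>s. 0)" using that by (auto simp: P_def indicator_def)
      then show ?thesis using False by simp
    qed
    then show "integrable lborel (\<lambda>s. P s u)"
      "(\<integral>s. P s u \<partial>lborel) = indicator {0..<t} u * Beta a b"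
      using integrable_lborel_nonneg_has_integral[of "\<lambda>s. P s u"] P0 Pm by auto
  qed
  have int2: "integrable lborel (\<lambda>u. P s u *\<^sub>R k' u)" for s
  proof (rule Bochner_Integration.integrable_bound)
    show "integrable lborel (\<lambda>u. M * P s u)" using Pu(1) by (rule integrable_mult_right)
    show "AE u in lborel. norm (P s u *\<^sub>R k' u) \<le> norm (M * P s u)"
    proof (rule AE_I2)
      fix u
      have "norm (P s u *\<^sub>R k' u) = norm (k' u) * P s u" using P0 by (simp add: mult.commute)
      also have "\<dots> \<le> M * P s u" using M' P0 by (intro mult_right_mono)
      finally show "norm (P s u *\<^sub>R k' u) \<le> norm (M * P s u)" by simp
    qed
  qed (use Pm in measurable)
  \<comment> \<open>Up to the factor \<open>M\<close> this dominates the inner integral of the norm,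
    which supplies the integrability condition of Fubini's theorem.\<close>
  have int1: "integrable lborel (\<lambda>s. indicator {0..t} s * ((t - s) powr (a - 1) * (s powr b / b)))"
  proof -
    have "(\<lambda>s. (t - s) powr (a - 1) *\<^sub>R (s powr b / b)) integrable_on {0..t}"
      using ab by (intro abel_kernel_integrable) (auto intro!: continuous_intros continuous_on_powr')
    then obtain I where "((\<lambda>s. (t - s) powr (a - 1) * (s powr b / b)) has_integral I) {0..t}"
      by (auto simp: integrable_on_def)
    then have I: "((\<lambda>s. if s \<in> {0..t} then (t - s) powr (a - 1) * (s powr b / b) else 0) has_integral I) UNIV"
      by (subst has_integral_restrict_UNIV) simp
    have e: "(\<lambda>s. if s \<in> {0..t} then (t - s) powr (a - 1) * (s powr b / b) else 0) = (\<lambda>s. indicator {0..t} s * ((t - s) powr (a - 1) * (s powr b / b)))"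
      by auto
    show ?thesis
      using I unfolding e
      by (intro integrable_lborel_nonneg_has_integral(1)) (use ab in \<open>auto\<close>)
  qed
  interpret lborel_pair: pair_sigma_finite lborel lborel ..
  have int: "integrable (lborel \<Otimes>\<^sub>M lborel) (\<lambda>p. P (fst p) (snd p) *\<^sub>R k' (snd p))"
  proof (rule lborel_pair.Fubini_integrable)
    have "integrable lborel (\<lambda>s. \<integral>u. norm (P s u *\<^sub>R k' u) \<partial>lborel)"
    proof (rule Bochner_Integration.integrable_bound)
      show "integrable lborel (\<lambda>s. M * (indicator {0..t} s * ((t - s) powr (a - 1) * (s powr b / b))))"
        using int1 by (rule integrable_mult_right)
      show "AE s in lborel. norm (\<integral>u. norm (P s u *\<^sub>R k' u) \<partial>lborel) \<le> norm (M * (indicator {0..t} s * ((t - s) powr (a - 1) * (s powr b / b))))"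
      proof (rule AE_I2)
        fix s
        have "(\<integral>u. norm (P s u *\<^sub>R k' u) \<partial>lborel) \<le> (\<integral>u. M * P s u \<partial>lborel)"
          using integrable_norm[OF int2[of s]] Pu(1)[of s] M' P0
          by (intro integral_mono) (auto simp: mult.commute[of M] intro!: mult_left_mono)
        also have "\<dots> = M * (indicator {0..t} s * ((t - s) powr (a - 1) * (s powr b / b)))"
          using Pu[of s] by simp
        finally have "(\<integral>u. norm (P s u *\<^sub>R k' u) \<partial>lborel)
          \<le> M * (indicator {0..t} s * ((t - s) powr (a - 1) * (s powr b / b)))" .
        moreover have "0 \<le> (\<integral>u. norm (P s u *\<^sub>R k' u) \<partial>lborel)"
          by (intro Bochner_Integration.integral_nonneg) auto
        ultimately show "norm (\<integral>u. norm (P s u *\<^sub>R k' u) \<partial>lborel)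
          \<le> norm (M * (indicator {0..t} s * ((t - s) powr (a - 1) * (s powr b / b))))"
          unfolding real_norm_def by linarith
      qed
    qed measurable
    then show "integrable lborel (\<lambda>s. \<integral>u. norm (P (fst (s, u)) (snd (s, u)) *\<^sub>R k' (snd (s, u))) \<partial>lborel)"
      by simp
  qed (use int2 in auto)
  have "(\<integral>u. (\<integral>s. P s u *\<^sub>R k' u \<partial>lborel) \<partial>lborel) = (\<integral>s. (\<integral>u. P s u *\<^sub>R k' u \<partial>lborel) \<partial>lborel)"
    by (rule lborel_pair.Fubini_integral) (use int in \<open>simp add: case_prod_beta'\<close>)
  moreover have "(\<integral>u. (\<integral>s. P s u *\<^sub>R k' u \<partial>lborel) \<partial>lborel) = Beta a b *\<^sub>R integral {0..t} k"
  proof -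
    have "(\<integral>u. (\<integral>s. P s u *\<^sub>R k' u \<partial>lborel) \<partial>lborel) = (\<integral>u. Beta a b *\<^sub>R (indicator {0..t} u *\<^sub>R k' u) \<partial>lborel)"
    proof (rule integral_cong_AE)
      have "AE u in lborel. u \<noteq> t" by (rule AE_lborel_singleton)
      then show "AE u in lborel. (\<integral>s. P s u *\<^sub>R k' u \<partial>lborel) = Beta a b *\<^sub>R (indicator {0..t} u *\<^sub>R k' u)"
      proof eventually_elim
        case (elim u)
        have "(\<integral>s. P s u *\<^sub>R k' u \<partial>lborel) = (\<integral>s. P s u \<partial>lborel) *\<^sub>R k' u"
          using Ps(1)[OF elim] by simp
        then show ?case using elim by (auto simp: Ps indicator_def)
      qed
    qed measurable
    also have "\<dots> = Beta a b *\<^sub>R (\<integral>u. indicator {0..t} u *\<^sub>R k' u \<partial>lborel)"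
      by (rule integral_scaleR_right)
    also have "(\<integral>u. indicator {0..t} u *\<^sub>R k' u \<partial>lborel) = integral {0..t} k'"
    proof -
      have "set_integrable lborel {0..t} k'"
        by (rule borel_integrable_atLeastAtMost') (rule continuous_on_subset[OF k'_cont], simp)
      from set_borel_integral_eq_integral(2)[OF this] show ?thesis by (simp add: set_lebesgue_integral_def)
    qed
    also have "integral {0..t} k' = integral {0..t} k"
      by (rule integral_cong) (simp add: k'_def)
    finally show ?thesis .
  qed
  moreover have "(\<integral>s. (\<integral>u. P s u *\<^sub>R k' u \<partial>lborel) \<partial>lborel) = abel_int a (abel_int b k) t"
  proof -
    have in_eq: "(\<integral>u. P s u *\<^sub>R k' u \<partial>lborel) = (if s \<in> {0..t} then (t - s) powr (a - 1) *\<^sub>R abel_int b k s else 0)" for s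
    proof (cases "s \<in> {0..t}")
      case True
      have "(\<integral>u. P s u *\<^sub>R k' u \<partial>lborel) = integral UNIV (\<lambda>u. P s u *\<^sub>R k' u)"
        using int2[of s] by (simp add: integral_lborel)
      also have "integral UNIV (\<lambda>u. P s u *\<^sub>R k' u) = integral UNIV
          (\<lambda>u. if u \<in> {0..s} then (t - s) powr (a - 1) *\<^sub>R ((s - u) powr (b - 1) *\<^sub>R k u) else 0)"
        using True by (intro integral_cong) (auto simp: P_def k'_def)
      also have "\<dots> = integral {0..s} (\<lambda>u. (t - s) powr (a - 1) *\<^sub>R ((s - u) powr (b - 1) *\<^sub>R k u))"
        by (rule integral_restrict_UNIV)
      also have "\<dots> = (t - s) powr (a - 1) *\<^sub>R abel_int b k s"
        by (simp only: integral_cmul abel_int_def)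
      finally show ?thesis using True by simp
    qed (auto simp: P_def)
    have "integrable lborel (\<lambda>s. \<integral>u. P s u *\<^sub>R k' u \<partial>lborel)"
      using lborel_pair.integrable_fst'[OF int] by simp
    then have "(\<integral>s. (\<integral>u. P s u *\<^sub>R k' u \<partial>lborel) \<partial>lborel) = integral UNIV (\<lambda>s. \<integral>u. P s u *\<^sub>R k' u \<partial>lborel)"
      by (simp add: integral_lborel)
    also have "\<dots> = abel_int a (abel_int b k) t"
      unfolding in_eq integral_restrict_UNIV abel_int_def ..
    finally show ?thesis .
  qed
  ultimately show ?thesis by simp
qed

text \<open>Since \<open>Gamma (a + b) = Gamma 1 = 1\<close>, the factor \<open>Beta a b\<close> is
  \<open>Gamma a * Gamma b\<close> and cancels the normalizations.\<close>

lemma RL_int_RL_int: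
  fixes k :: "real \<Rightarrow> 'a::euclidean_space"
  assumes "0 < a" "0 < b" "a + b = 1" "0 \<le> t" "continuous_on {0..t} k"
  shows "RL_int a (RL_int b k) t = integral {0..t} k"
proof -
  have "RL_int a (RL_int b k) t = (1 / Gamma a) *\<^sub>R abel_int a (\<lambda>s. (1 / Gamma b) *\<^sub>R abel_int b k s) t"
    unfolding RL_int_eq_abel_int[abs_def] ..
  also have "\<dots> = (1 / (Gamma a * Gamma b)) *\<^sub>R abel_int a (abel_int b k) t"
    by (simp add: abel_int_scaleR)
  also have "\<dots> = integral {0..t} k"
    using assms Gamma_real_pos[of a] Gamma_real_pos[of b]
    by (simp add: abel_int_abel_int Beta_def less_imp_neq[symmetric])
  finally show ?thesis .
qed

section \<open>A maximum principle\<close>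

text \<open>Again \<open>w \<le> w powr \<beta>\<close> on the unit interval, at
  \<open>w = (y - h) / y\<close>. Compared with the tangent the factor \<open>\<beta>\<close> is
  replaced by \<open>1\<close>; this makes it an upper bound valid up to
  \<open>h = y\<close>.\<close>

lemma powr_diff_le_linear:
  fixes \<beta> y h :: real
  assumes "0 < \<beta>" "\<beta> < 1" "0 < y" "0 \<le> h" "h \<le> y"
  shows "y powr \<beta> - (y - h) powr \<beta> \<le> h * y powr (\<beta> - 1)"
proof -
  define w where "w = (y - h) / y"
  have w: "0 \<le> w" "w \<le> 1" using assms by (auto simp: w_def)
  have "y powr \<beta> * w \<le> y powr \<beta> * w powr \<beta>"
    using powr_mono'[of \<beta> 1 w] w assms by (intro mult_left_mono) auto
  also have "\<dots> = (y - h) powr \<beta>" using assms w by (simp add: w_def powr_divide)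
  also have "y powr \<beta> * w = y powr \<beta> - h * y powr (\<beta> - 1)"
    using assms by (simp add: w_def powr_diff field_simps)
  finally show ?thesis by simp
qed

text \<open>A concave power lies below its tangent at \<open>y\<close>; in the variable
  \<open>w = (y - h) / y\<close> this is Young's inequality for \<open>w\<close> and
  \<open>1\<close>.\<close>

lemma powr_diff_ge_linear:
  fixes \<beta> y h :: real
  assumes "0 < \<beta>" "\<beta> < 1" "0 < y" "0 \<le> h" "h < y"
  shows "\<beta> * (h * y powr (\<beta> - 1)) \<le> y powr \<beta> - (y - h) powr \<beta>"
proof -
  define w where "w = (y - h) / y"
  have w: "0 < w" using assms by (auto simp: w_def)
  have "w powr \<beta> * 1 powr (1 - \<beta>) \<le> \<beta> * w + (1 - \<beta>) * 1"
    using w assms by (intro Youngs_inequality_0) auto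
  then have "y powr \<beta> * w powr \<beta> \<le> y powr \<beta> * (\<beta> * w + (1 - \<beta>))"
    by (intro mult_left_mono) auto
  also have "y powr \<beta> * w powr \<beta> = (y - h) powr \<beta>" using assms w by (simp add: w_def powr_divide)
  also have "y powr \<beta> * (\<beta> * w + (1 - \<beta>)) = y powr \<beta> - \<beta> * (h * y powr (\<beta> - 1))"
    using assms by (simp add: w_def powr_diff field_simps)
  finally show ?thesis by simp
qed

lemma abel_int_const:
  assumes "0 < \<beta>" "0 \<le> t"
  shows "abel_int \<beta> (\<lambda>s. c) t = (t powr \<beta> / \<beta>) *\<^sub>R c"
proof -
  have "((\<lambda>s. (t - s) powr (\<beta> - 1) *\<^sub>R c) has_integral (((t - 0) powr \<beta> - (t - t) powr \<beta>) / \<beta>) *\<^sub>R c) {0..t}"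
    by (intro has_integral_scaleR_left abel_kernel_has_integral) (use assms in auto)
  then show ?thesis by (simp add: abel_int_def integral_unique)
qed

text \<open>After subtraction of the constant \<open>k t\<close> the integrand is small near
  \<open>t\<close>, so \<open>abel_int_diff_bound\<close> gives a small coefficient of
  \<open>(t - s) powr \<beta>\<close>. The part far from \<open>t\<close> and the constant
  contribute \<open>O(t - s)\<close>, which is of lower order because
  \<open>\<beta> < 1\<close>.\<close>

lemma abel_int_little_hoelder:
  fixes k :: "real \<Rightarrow> 'a::euclidean_space"
  assumes \<beta>: "0 < \<beta>" "\<beta> < 1" and t: "0 < t" and k: "continuous_on {0..t} k" and e: "0 < e"
  shows "\<exists>\<delta>>0. \<forall>s\<in>{0..t}. t - s < \<delta> \<longrightarrow> norm (abel_int \<beta> k t - abel_int \<beta> k s) \<le> e * (t - s) powr \<beta>"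
proof -
  define c where "c = k t"
  define k' where "k' s = k s - c" for s
  have k'_cont: "continuous_on {0..t} k'"
    unfolding k'_def by (intro continuous_intros k)
  have "bounded (k' ` {0..t})"
    using k'_cont by (intro compact_imp_bounded compact_continuous_image) auto
  then obtain M where M: "\<And>s. s \<in> {0..t} \<Longrightarrow> norm (k' s) \<le> M"
    unfolding bounded_iff by blast
  have M0: "0 \<le> M" using order_trans[OF norm_ge_zero M[of 0]] t by simp
  \<comment> \<open>With this bound near \<open>t\<close> the Hoelder coefficient
    \<open>2 * \<epsilon> / \<beta>\<close> becomes \<open>e / 2\<close>.\<close>
  have "e * \<beta> / 4 > 0" using e \<beta> by simp
  then obtain d0 where d0: "d0 > 0" "\<And>s. s \<in> {0..t} \<Longrightarrow> dist s t < d0 \<Longrightarrow> dist (k s) (k t) < e * \<beta> / 4"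
    using k t unfolding continuous_on_iff by (metis atLeastAtMost_iff less_imp_le order_refl)
  define d where "d = max (t / 2) (t - d0 / 2)"
  have d: "0 \<le> d" "d < t" using t d0 by (auto simp: d_def)
  have near: "norm (k' s) \<le> e * \<beta> / 4" if "s \<in> {d..t}" for s
    using d0(2)[of s] that d d0(1) t by (auto simp: k'_def c_def dist_norm d_def)
  \<comment> \<open>The sum of the Lipschitz constants of the far part of \<open>k'\<close> and of
    the Abel integral of the constant \<open>c\<close>.\<close>
  define N where "N = (M * (t - d) powr (\<beta> - 1) + norm c * t powr (\<beta> - 1)) / \<beta>"
  have N: "0 \<le> N" using M0 \<beta> by (simp add: N_def)
  \<comment> \<open>Chosen so that \<open>s\<close> lies beyond \<open>d\<close> and
    \<open>(t - s) powr (1 - \<beta>) * N \<le> e / 2\<close>; the summand \<open>1\<close> keeps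
    the denominator positive when \<open>N = 0\<close>.\<close>
  define \<delta> where "\<delta> = min (t - d) ((e / (2 * (N + 1))) powr (1 / (1 - \<beta>)))"
  have "norm (abel_int \<beta> k t - abel_int \<beta> k s) \<le> e * (t - s) powr \<beta>"
    if s: "s \<in> {0..t}" "t - s < \<delta>" for s
  proof -
    have sd: "d \<le> s" "s \<le> t" "t - s \<le> t" "t - s \<le> t - d" using s by (auto simp: \<delta>_def)
    have split: "abel_int \<beta> k r = abel_int \<beta> k' r + (r powr \<beta> / \<beta>) *\<^sub>R c" if "r \<in> {0..t}" for r
    proof -
      have "abel_int \<beta> k' r = abel_int \<beta> k r - abel_int \<beta> (\<lambda>_. c) r"
        unfolding k'_def using that
        by (intro abel_int_diff \<beta> continuous_on_subset[OF k] continuous_intros) auto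
      then show ?thesis using that \<beta> by (simp add: abel_int_const)
    qed
    have "abel_int \<beta> k t - abel_int \<beta> k s
      = (abel_int \<beta> k' t - abel_int \<beta> k' s) + ((t powr \<beta> - s powr \<beta>) / \<beta>) *\<^sub>R c"
      using split[of t] split[of s] s t by (simp add: algebra_simps diff_divide_distrib)
    then have "norm (abel_int \<beta> k t - abel_int \<beta> k s)
      \<le> norm (abel_int \<beta> k' t - abel_int \<beta> k' s) + norm (((t powr \<beta> - s powr \<beta>) / \<beta>) *\<^sub>R c)"
      by (simp only: norm_triangle_ineq)
    also have "norm (abel_int \<beta> k' t - abel_int \<beta> k' s) \<le> 2 * (e * \<beta> / 4) * (t - s) powr \<beta> / \<beta>
        + M * ((t - d) powr \<beta> - (s - d) powr \<beta>) / \<beta>"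
      by (intro abel_int_diff_bound \<beta> k'_cont near M) (use d sd in auto)
    also have "M * ((t - d) powr \<beta> - (s - d) powr \<beta>) / \<beta> \<le> M * ((t - s) * (t - d) powr (\<beta> - 1)) / \<beta>"
      using powr_diff_le_linear[of \<beta> "t - d" "t - s"] sd d \<beta> M0
      by (intro divide_right_mono mult_left_mono) auto
    also have "norm (((t powr \<beta> - s powr \<beta>) / \<beta>) *\<^sub>R c) \<le> ((t - s) * t powr (\<beta> - 1)) / \<beta> * norm c"
    proof -
      have "s powr \<beta> \<le> t powr \<beta>" using s \<beta> by (intro powr_mono2) auto
      then have "norm (((t powr \<beta> - s powr \<beta>) / \<beta>) *\<^sub>R c) = (t powr \<beta> - s powr \<beta>) / \<beta> * norm c"
        using \<beta> by simp
      also have "\<dots> \<le> ((t - s) * t powr (\<beta> - 1)) / \<beta> * norm c"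
        using powr_diff_le_linear[of \<beta> t "t - s"] sd \<beta> t s
        by (intro divide_right_mono mult_right_mono) auto
      finally show ?thesis .
    qed
    also have "2 * (e * \<beta> / 4) * (t - s) powr \<beta> / \<beta> + M * ((t - s) * (t - d) powr (\<beta> - 1)) / \<beta> +
      ((t - s) * t powr (\<beta> - 1)) / \<beta> * norm c = e / 2 * (t - s) powr \<beta> + (t - s) * N"
      using \<beta> by (simp add: N_def field_simps)
    also have "(t - s) * N \<le> e / 2 * (t - s) powr \<beta>"
    proof -
      have "(t - s) powr (1 - \<beta>) \<le> \<delta> powr (1 - \<beta>)" using s \<beta> by (intro powr_mono2) auto
      also have "\<dots> \<le> ((e / (2 * (N + 1))) powr (1 / (1 - \<beta>))) powr (1 - \<beta>)"
        using d e N \<beta> by (intro powr_mono2) (auto simp: \<delta>_def)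
      also have "\<dots> = e / (2 * (N + 1))" using \<beta> e N by (simp add: powr_powr)
      finally have "(t - s) powr (1 - \<beta>) * N \<le> e / (2 * (N + 1)) * N" using N by (intro mult_right_mono)
      also have "\<dots> \<le> e / 2" using N e by (simp add: field_simps)
      finally have "(t - s) powr \<beta> * ((t - s) powr (1 - \<beta>) * N) \<le> (t - s) powr \<beta> * (e / 2)"
        by (intro mult_left_mono) auto
      moreover have "(t - s) powr \<beta> * (t - s) powr (1 - \<beta>) = t - s"
        using sd by (simp flip: powr_add)
      ultimately show ?thesis by (metis mult.assoc mult.commute)
    qed
    finally show ?thesis by simp
  qed
  moreover have "\<delta> > 0" using d e N by (simp add: \<delta>_def)
  ultimately show ?thesis by blast
qed

lemma abel_int_eq_integral:
  fixes k :: "real \<Rightarrow> 'a::euclidean_space"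
  assumes "0 < \<alpha>" "\<alpha> < 1" "0 \<le> t" "continuous_on {0..t} k"
  shows "abel_int (1 - \<alpha>) (RL_int \<alpha> k) t = Gamma (1 - \<alpha>) *\<^sub>R integral {0..t} k"
proof -
  have "Gamma (1 - \<alpha>) > 0" using assms by (intro Gamma_real_pos) auto
  then have G: "Gamma (1 - \<alpha>) \<noteq> 0" by simp
  have "Gamma (1 - \<alpha>) *\<^sub>R integral {0..t} k = Gamma (1 - \<alpha>) *\<^sub>R RL_int (1 - \<alpha>) (RL_int \<alpha> k) t"
    using assms by (simp add: RL_int_RL_int)
  also have "\<dots> = abel_int (1 - \<alpha>) (RL_int \<alpha> k) t"
    using G by (simp add: RL_int_eq_abel_int[of "1 - \<alpha>"])
  finally show ?thesis ..
qed

lemma continuous_on_RL_int: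
  assumes "0 < \<beta>" "\<beta> < 1" "continuous_on {0..T} k"
  shows "continuous_on {0..T} (RL_int \<beta> k)"
  unfolding RL_int_eq_abel_int[abs_def]
  by (intro continuous_intros continuous_on_abel_int assms)

text \<open>Moving the evaluation point from \<open>t - h\<close> to \<open>t\<close> lowers the
  kernel on \<open>{0..t-h}\<close>, so with \<open>u\<close> nonnegative only
  \<open>{t-h..t}\<close> can increase the integral. There the bound on \<open>u\<close> cancels the
  kernel \<open>(t - s) powr (- \<alpha>)\<close>.\<close>

lemma abel_int_max_left_difference:
  fixes u :: "real \<Rightarrow> real"
  assumes \<alpha>: "0 < \<alpha>" "\<alpha> < 1" and h: "0 < h" "h < t" and u: "continuous_on {0..t} u"
    and u0: "\<And>s. s \<in> {0..t} \<Longrightarrow> 0 \<le> u s"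
    and ue: "\<And>s. s \<in> {t - h..t} \<Longrightarrow> u s \<le> e * (t - s) powr \<alpha>" and e: "0 < e"
  shows "abel_int (1 - \<alpha>) u t - abel_int (1 - \<alpha>) u (t - h) \<le> e * h"
proof -
  have cont: "continuous_on {0..t-h} u" "continuous_on {t-h..t} u"
    by (rule continuous_on_subset[OF u]; use h in auto)+
  have n: "negligible {t - h}" by simp
  \<comment> \<open>The point \<open>t - h\<close> must go: there the larger kernel has the value
    \<open>0 powr (- \<alpha>) = 0\<close>, which breaks the pointwise comparison.\<close>
  have sp: "integral {0..t-h} g = integral ({0..t-h} - {t - h}) g" for g :: "real \<Rightarrow> real"
    by (rule integral_spike_set) (auto intro: negligible_subset[OF n])
  have sp': "g integrable_on ({0..t-h} - {t - h})" if "g integrable_on {0..t-h}" for g :: "real \<Rightarrow> real"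
    using that by (rule integrable_spike_set) (auto intro: negligible_subset[OF n])
  have "integral {0..t-h} (\<lambda>s. (t - s) powr ((1 - \<alpha>) - 1) *\<^sub>R u s)
    \<le> integral {0..t-h} (\<lambda>s. (t - h - s) powr ((1 - \<alpha>) - 1) *\<^sub>R u s)"
    unfolding sp
    using \<alpha> h u0 cont
    by (intro integral_le sp' abel_kernel_integrable)
       (auto intro!: mult_right_mono powr_mono2')
  moreover have "integral {t-h..t} (\<lambda>s. (t - s) powr ((1 - \<alpha>) - 1) *\<^sub>R u s) \<le> integral {t-h..t} (\<lambda>s. e)"
  proof (rule integral_le)
    show "(\<lambda>s. (t - s) powr ((1 - \<alpha>) - 1) *\<^sub>R u s) integrable_on {t-h..t}"
      using \<alpha> cont by (intro abel_kernel_integrable) auto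
    fix s assume s: "s \<in> {t-h..t}"
    have "(t - s) powr ((1 - \<alpha>) - 1) * u s \<le> (t - s) powr ((1 - \<alpha>) - 1) * (e * (t - s) powr \<alpha>)"
      using ue[OF s] by (intro mult_left_mono) auto
    \<comment> \<open>The powers cancel for \<open>s < t\<close>; at \<open>s = t\<close> the
      product is \<open>0\<close> because \<open>0 powr _ = 0\<close>.\<close>
    also have "\<dots> \<le> e"
      using e s by (cases "s = t") (auto simp: powr_minus field_simps)
    finally show "(t - s) powr ((1 - \<alpha>) - 1) *\<^sub>R u s \<le> e" by simp
  qed auto
  ultimately show ?thesis
    using abel_int_split[of "1 - \<alpha>" "t - h" t u] \<alpha> h u
    by (simp add: abel_int_def mult.commute)
qed

text \<open>In the role of \<open>k\<close> think of the Caputo derivative of \<open>q\<close>. The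
  function \<open>u = q t - q\<close> is nonnegative and vanishes at \<open>t\<close>, so its Abel
  integral grows by at most \<open>e * h\<close> over \<open>{t-h..t}\<close>. Equation
  \<open>A\<close> turns this growth into an increment of a power minus an integral of
  \<open>k\<close>, and division by \<open>h\<close> gives the claim up to
  \<open>e'\<close>.\<close>

lemma RL_int_max_principle:
  fixes k q :: "real \<Rightarrow> real"
  assumes \<alpha>: "0 < \<alpha>" "\<alpha> < 1" and t: "0 < t" and k: "continuous_on {0..t} k"
    and q: "\<And>s. s \<in> {0..t} \<Longrightarrow> q s = q0 + RL_int \<alpha> k s"
    and max: "\<And>s. s \<in> {0..t} \<Longrightarrow> q s \<le> q t"
  shows "(q t - q0) * t powr (- \<alpha>) \<le> Gamma (1 - \<alpha>) * k t"
proof (rule field_le_epsilon)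
  fix e' :: real assume "0 < e'"
  \<comment> \<open>One half pays for the left difference of the Abel integral, the other for the
    oscillation of \<open>k\<close> on \<open>{t-h..t}\<close>.\<close>
  define e where "e = e' / 2"
  have e: "0 < e" "e' = e + e" using \<open>0 < e'\<close> by (auto simp: e_def)
  have G: "Gamma (1 - \<alpha>) > 0" "Gamma \<alpha> > 0" using \<alpha> by (auto intro!: Gamma_real_pos)
  define u where "u s = q t - q s" for s
  have qc: "continuous_on {0..t} q"
    using continuous_on_RL_int[OF \<alpha> k] q by (subst continuous_on_cong[OF refl q]) (auto intro!: continuous_intros)
  then have uc: "continuous_on {0..t} u" unfolding u_def by (intro continuous_intros)
  obtain \<delta>1 where \<delta>1: "\<delta>1 > 0" "\<And>s. s \<in> {0..t} \<Longrightarrow> t - s < \<delta>1 \<Longrightarrow>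
      norm (abel_int \<alpha> k t - abel_int \<alpha> k s) \<le> (Gamma \<alpha> * e) * (t - s) powr \<alpha>"
    using abel_int_little_hoelder[OF \<alpha> t k, of "Gamma \<alpha> * e"] G e by auto
  have "e / Gamma (1 - \<alpha>) > 0" using G e by simp
  then obtain \<delta>2 where \<delta>2: "\<delta>2 > 0" "\<And>s. s \<in> {0..t} \<Longrightarrow> dist s t < \<delta>2 \<Longrightarrow> dist (k s) (k t) < e / Gamma (1 - \<alpha>)"
    using k t unfolding continuous_on_iff by (metis atLeastAtMost_iff less_imp_le order_refl)
  define h where "h = min (t / 2) (min (\<delta>1 / 2) (\<delta>2 / 2))"
  have h: "0 < h" "h < t" "h < \<delta>1" "h < \<delta>2" using t \<delta>1 \<delta>2 by (auto simp: h_def)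
  have A: "abel_int (1 - \<alpha>) u r = (q t - q0) * (r powr (1 - \<alpha>) / (1 - \<alpha>)) - Gamma (1 - \<alpha>) * integral {0..r} k"
    if r: "r \<in> {0..t}" for r
  proof -
    have kr: "continuous_on {0..r} k" using k r by (auto intro: continuous_on_subset)
    have "abel_int (1 - \<alpha>) u r = abel_int (1 - \<alpha>) (\<lambda>s. (q t - q0) - RL_int \<alpha> k s) r"
      using r by (intro abel_int_cong) (auto simp: u_def q)
    also have "\<dots> = abel_int (1 - \<alpha>) (\<lambda>s. q t - q0) r - abel_int (1 - \<alpha>) (RL_int \<alpha> k) r"
      using \<alpha> kr by (intro abel_int_diff continuous_on_RL_int) auto
    also have "\<dots> = (q t - q0) * (r powr (1 - \<alpha>) / (1 - \<alpha>)) - Gamma (1 - \<alpha>) * integral {0..r} k"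
      using \<alpha> kr r by (simp add: abel_int_const abel_int_eq_integral)
    finally show ?thesis .
  qed
  have "abel_int (1 - \<alpha>) u t - abel_int (1 - \<alpha>) u (t - h) \<le> e * h"
  proof (rule abel_int_max_left_difference[OF \<alpha> h(1,2) uc])
    fix s assume s: "s \<in> {t - h..t}"
    then have s': "s \<in> {0..t}" using h by auto
    have "u s = (1 / Gamma \<alpha>) * (abel_int \<alpha> k t - abel_int \<alpha> k s)"
      using q[OF s'] q[of t] t by (simp add: u_def RL_int_eq_abel_int diff_divide_distrib)
    also have "\<dots> \<le> (1 / Gamma \<alpha>) * ((Gamma \<alpha> * e) * (t - s) powr \<alpha>)"
      using \<delta>1(2)[OF s'] s h G by (intro mult_left_mono) auto
    finally show "u s \<le> e * (t - s) powr \<alpha>" using G by simp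
  qed (use max e in \<open>auto simp: u_def\<close>)
  moreover have "integral {0..t} k = integral {0..t-h} k + integral {t-h..t} k"
    using k h
    by (intro Henstock_Kurzweil_Integration.integral_combine[symmetric] integrable_continuous_real) auto
  ultimately have "(q t - q0) * ((t powr (1 - \<alpha>) - (t - h) powr (1 - \<alpha>)) / (1 - \<alpha>))
      - e * h \<le> Gamma (1 - \<alpha>) * integral {t-h..t} k"
    using A[of t] A[of "t - h"] h t by (simp add: algebra_simps diff_divide_distrib)
  \<comment> \<open>Concavity of the power with exponent \<open>1 - \<alpha>\<close>; the factor
    \<open>q t - q0\<close> is nonnegative because \<open>q0\<close> is the value of
    \<open>q\<close> at \<open>0\<close>.\<close>
  moreover have "(q t - q0) * (h * t powr (- \<alpha>)) \<le> (q t - q0) * ((t powr (1 - \<alpha>) - (t - h) powr (1 - \<alpha>)) / (1 - \<alpha>))"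
  proof (rule mult_left_mono)
    show "h * t powr (- \<alpha>) \<le> (t powr (1 - \<alpha>) - (t - h) powr (1 - \<alpha>)) / (1 - \<alpha>)"
      using powr_diff_ge_linear[of "1 - \<alpha>" t h] \<alpha> t h by (simp add: field_simps)
    show "0 \<le> q t - q0" using max[of 0] q[of 0] t by (simp add: RL_int_def)
  qed
  moreover have "Gamma (1 - \<alpha>) * integral {t-h..t} k \<le> Gamma (1 - \<alpha>) * (h * (k t + e / Gamma (1 - \<alpha>)))"
  proof (rule mult_left_mono)
    have "integral {t-h..t} k \<le> integral {t-h..t} (\<lambda>s. k t + e / Gamma (1 - \<alpha>))"
    proof (rule integral_le)
      show "k integrable_on {t-h..t}"
        by (intro integrable_continuous_real continuous_on_subset[OF k]) (use h in auto)
      fix s assume "s \<in> {t-h..t}"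
      then show "k s \<le> k t + e / Gamma (1 - \<alpha>)"
        using \<delta>2(2)[of s] h by (auto simp: dist_real_def)
    qed auto
    then show "integral {t-h..t} k \<le> h * (k t + e / Gamma (1 - \<alpha>))" using h by simp
  qed (use G in simp)
  moreover have "Gamma (1 - \<alpha>) * (h * (k t + e / Gamma (1 - \<alpha>))) = h * (Gamma (1 - \<alpha>) * k t + e)"
    using G by (simp add: field_simps)
  ultimately have "h * ((q t - q0) * t powr (- \<alpha>)) \<le> h * (Gamma (1 - \<alpha>) * k t + e')"
    by (simp add: e(2) algebra_simps)
  then show "(q t - q0) * t powr (- \<alpha>) \<le> Gamma (1 - \<alpha>) * k t + e'"
    using h by simp
qed

section \<open>The integral equation and comparison of Lyapunov functions\<close>

lemma continuous_on_atLeast_0I: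
  fixes F :: "real \<Rightarrow> 'a::topological_space"
  assumes "\<And>T. continuous_on {0..T} F"
  shows "continuous_on {0..} F"
  unfolding continuous_on_eq_continuous_within
proof
  fix t :: real assume t: "t \<in> {0..}"
  have "continuous (at t within {0..t + 1}) F"
    using assms[of "t + 1"] t by (simp add: continuous_on_eq_continuous_within)
  moreover have "at t within {0..t + 1} = at t within {0..}"
    by (rule at_within_nhd[of _ "{..<t + 1}"]) auto
  ultimately show "continuous (at t within {0..}) F" by simp
qed

lemma RL_int_0 [simp]: "RL_int \<beta> k 0 = 0"
  by (simp add: RL_int_def)

lemma RL_int_cong:
  assumes "\<And>s. s \<in> {0..t} \<Longrightarrow> k s = k' s"
  shows "RL_int \<beta> k t = RL_int \<beta> k' t"
  unfolding RL_int_eq_abel_int using abel_int_cong[OF assms] by simp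

lemma RL_int_diff:
  assumes "0 < \<beta>" "continuous_on {0..t} k" "continuous_on {0..t} k'"
  shows "RL_int \<beta> (\<lambda>s. k s - k' s) t = RL_int \<beta> k t - RL_int \<beta> k' t"
  unfolding RL_int_eq_abel_int abel_int_diff[OF assms] by (simp add: scaleR_diff_right)

lemma RL_int_inner:
  assumes "0 < \<beta>" "continuous_on {0..t} k"
  shows "RL_int \<beta> (\<lambda>s. p \<bullet> k s) t = p \<bullet> RL_int \<beta> k t"
  unfolding RL_int_eq_abel_int abel_int_inner[OF assms] by simp

text \<open>Integrating the equation gives \<open>RL_int (1 - \<alpha>)\<close> of
  \<open>x - x 0\<close> as the integral of \<open>h\<close>, which is also
  \<open>RL_int (1 - \<alpha>) (RL_int \<alpha> h)\<close>. Hence the defect \<open>e\<close>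
  satisfies \<open>RL_int (1 - \<alpha>) e = 0\<close>; applying \<open>RL_int \<alpha>\<close>
  makes every integral of \<open>e\<close> over \<open>{0..r}\<close> vanish, and differentiation
  gives \<open>e t = 0\<close>.\<close>

lemma caputo_imp_RL_int:
  fixes x h :: "real \<Rightarrow> 'a::euclidean_space"
  assumes \<alpha>: "0 < \<alpha>" "\<alpha> < 1"
    and x: "continuous_on {0..T} x" and h: "continuous_on {0..T} h"
    and D: "\<And>t. 0 < t \<Longrightarrow> t < T \<Longrightarrow>
      ((\<lambda>s. RL_int (1 - \<alpha>) (\<lambda>\<tau>. x \<tau> - x 0) s) has_vector_derivative h t) (at t)"
    and t: "t \<in> {0..T}"
  shows "x t = x 0 + RL_int \<alpha> h t"
proof (cases "T = 0")
  case True
  then show ?thesis using t by simp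
next
  case False
  then have T: "0 < T" using t by simp
  define e where "e s = (x s - x 0) - RL_int \<alpha> h s" for s
  have xc: "continuous_on {0..T} (\<lambda>s. x s - x 0)" by (intro continuous_intros x)
  have ec: "continuous_on {0..T} e"
    unfolding e_def by (intro continuous_intros x continuous_on_RL_int \<alpha> h)
  have F: "RL_int (1 - \<alpha>) (\<lambda>s. x s - x 0) r = integral {0..r} h" if r: "r \<in> {0..T}" for r
  proof -
    have "(h has_integral RL_int (1 - \<alpha>) (\<lambda>s. x s - x 0) r - RL_int (1 - \<alpha>) (\<lambda>s. x s - x 0) 0) {0..r}"
      by (rule fundamental_theorem_of_calculus_interior)
         (use r D \<alpha> in \<open>auto intro!: continuous_on_RL_int continuous_on_subset[OF xc]\<close>)
    then show ?thesis by (simp add: integral_unique)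
  qed
  have e0: "RL_int (1 - \<alpha>) e r = 0" if r: "r \<in> {0..T}" for r
  proof -
    have cr: "continuous_on {0..r} h" "continuous_on {0..r} (\<lambda>s. x s - x 0)"
      using r by (auto intro: continuous_on_subset[OF h] continuous_on_subset[OF xc])
    have "RL_int (1 - \<alpha>) e r = RL_int (1 - \<alpha>) (\<lambda>s. x s - x 0) r - RL_int (1 - \<alpha>) (RL_int \<alpha> h) r"
      unfolding e_def using \<alpha> cr by (intro RL_int_diff continuous_on_RL_int) auto
    then show ?thesis
      using F[OF r] RL_int_RL_int[of "1 - \<alpha>" \<alpha> r h] \<alpha> cr r by simp
  qed
  have int0: "integral {0..r} e = 0" if r: "r \<in> {0..T}" for r
  proof -
    have "integral {0..r} e = RL_int \<alpha> (RL_int (1 - \<alpha>) e) r"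
      using \<alpha> r by (intro RL_int_RL_int[symmetric] continuous_on_subset[OF ec]) auto
    also have "\<dots> = RL_int \<alpha> (\<lambda>_. 0) r" using e0 r by (intro RL_int_cong) auto
    finally show ?thesis by (simp add: RL_int_def)
  qed
  have "((\<lambda>r. integral {0..r} e) has_vector_derivative e t) (at t within {0..T})"
    using ec t by (rule integral_has_vector_derivative)
  then have "((\<lambda>r. 0) has_vector_derivative e t) (at t within {0..T})"
    by (rule has_vector_derivative_transform[rotated 2]) (use t int0 in auto)
  moreover have "((\<lambda>r. 0) has_vector_derivative (0::'a)) (at t within {0..T})" by simp
  ultimately have "e t = 0"
    using vector_derivative_unique_within_closed_interval[of 0 T t "\<lambda>r. 0" "e t" 0] T t by simp
  then show ?thesis by (simp add: e_def algebra_simps)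
qed

text \<open>By the composition rule the function to be differentiated agrees with the integral of
  \<open>h\<close> on the open half-line, so its derivative is given by the fundamental
  theorem.\<close>

lemma RL_int_imp_caputo:
  fixes x h :: "real \<Rightarrow> 'a::euclidean_space"
  assumes \<alpha>: "0 < \<alpha>" "\<alpha> < 1" and h: "continuous_on {0..} h"
    and x: "\<And>t. 0 \<le> t \<Longrightarrow> x t = x0 + RL_int \<alpha> h t" and t: "0 < t"
  shows "((\<lambda>s. RL_int (1 - \<alpha>) (\<lambda>\<tau>. x \<tau> - x 0) s) has_vector_derivative h t) (at t)"
proof -
  have hc: "continuous_on {0..r} h" for r by (rule continuous_on_subset[OF h]) auto
  have "((\<lambda>r. integral {0..r} h) has_vector_derivative h t) (at t within {0..t + 1})"
    using hc t by (intro integral_has_vector_derivative) auto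
  moreover have "at t within {0..t + 1} = at t" using t by (intro at_within_interior) auto
  ultimately have "((\<lambda>r. integral {0..r} h) has_vector_derivative h t) (at t)" by simp
  then show ?thesis
  proof (rule has_vector_derivative_transform_within_open)
    show "open {0::real<..}" "t \<in> {0<..}" using t by auto
    fix r :: real assume r: "r \<in> {0<..}"
    have "RL_int (1 - \<alpha>) (\<lambda>\<tau>. x \<tau> - x 0) r = RL_int (1 - \<alpha>) (RL_int \<alpha> h) r"
      by (intro RL_int_cong) (simp add: x)
    then show "integral {0..r} h = RL_int (1 - \<alpha>) (\<lambda>\<tau>. x \<tau> - x 0) r"
      using RL_int_RL_int[of "1 - \<alpha>" \<alpha> r h] r \<alpha> hc by simp
  qed
qed

section \<open>Gradients, tangent planes and the comparison principle\<close>

lemma frechet_derivative_eq_grad: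
  assumes "V differentiable (at x)"
  shows "frechet_derivative V (at x) v = grad V x \<bullet> v"
proof -
  interpret linear "frechet_derivative V (at x)"
    using assms by (rule linear_frechet_derivative)
  have "frechet_derivative V (at x) v = frechet_derivative V (at x) (\<Sum>i\<in>Basis. (v \<bullet> i) *\<^sub>R i)"
    by (simp add: euclidean_representation)
  also have "\<dots> = (\<Sum>i\<in>Basis. (v \<bullet> i) * frechet_derivative V (at x) i)"
    by (simp add: sum scale)
  also have "\<dots> = grad V x \<bullet> v"
    by (simp add: grad_def inner_sum_left inner_commute[of v] mult.commute)
  finally show ?thesis .
qed

text \<open>Restricting \<open>V\<close> to the line through \<open>x\<close> and \<open>z\<close>
  reduces this to the tangent of a convex function of one variable.\<close>

lemma convex_above_tangent_grad:
  fixes V :: "'a::euclidean_space \<Rightarrow> real"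
  assumes V: "convex_on UNIV V" "V differentiable (at x)"
  shows "V x + grad V x \<bullet> (z - x) \<le> V z"
proof -
  define \<phi> where "\<phi> s = V (x + s *\<^sub>R (z - x))" for s :: real
  have "convex_on UNIV \<phi>"
  proof (rule convex_onI)
    fix t a b :: real assume t: "0 < t" "t < 1"
    have "x + ((1 - t) *\<^sub>R a + t *\<^sub>R b) *\<^sub>R (z - x)
      = (1 - t) *\<^sub>R (x + a *\<^sub>R (z - x)) + t *\<^sub>R (x + b *\<^sub>R (z - x))"
      by (simp add: algebra_simps)
    then show "\<phi> ((1 - t) *\<^sub>R a + t *\<^sub>R b) \<le> (1 - t) * \<phi> a + t * \<phi> b"
      using convex_onD[OF V(1), of t "x + a *\<^sub>R (z - x)" "x + b *\<^sub>R (z - x)"] t by (simp add: \<phi>_def)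
  qed simp
  moreover have "(\<phi> has_field_derivative grad V x \<bullet> (z - x)) (at 0 within UNIV)"
  proof -
    have "(V has_derivative frechet_derivative V (at x)) (at (x + 0 *\<^sub>R (z - x)))"
      using V(2) by (simp add: frechet_derivative_works)
    moreover have "((\<lambda>s. x + s *\<^sub>R (z - x)) has_derivative (\<lambda>s. s *\<^sub>R (z - x))) (at (0::real))"
      by (auto intro!: derivative_eq_intros)
    ultimately have "(\<phi> has_derivative (\<lambda>s. frechet_derivative V (at x) (s *\<^sub>R (z - x)))) (at 0)"
      unfolding \<phi>_def by (rule has_derivative_compose[rotated])
    then show ?thesis
      by (simp add: frechet_derivative_eq_grad[OF V(2)] has_field_derivative_def mult_commute_abs)
  qed
  ultimately have "(grad V x \<bullet> (z - x)) * (1 - 0) \<le> \<phi> 1 - \<phi> 0"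
    by (intro convex_on_imp_above_tangent) auto
  then show ?thesis by (simp add: \<phi>_def)
qed

text \<open>The barrier \<open>y\<close> is given through its ordinary derivative \<open>y'\<close>,
  so its Caputo derivative is \<open>RL_int (1 - \<alpha>) y'\<close>. The decay condition
  \<open>dec\<close> is asked for only at times when the barrier is exceeded, which later lets it be
  checked away from the origin.\<close>

lemma lyapunov_comparison:
  fixes x h :: "real \<Rightarrow> 'a::euclidean_space" and V :: "'a \<Rightarrow> real" and y y' :: "real \<Rightarrow> real"
  assumes \<alpha>: "0 < \<alpha>" "\<alpha> < 1"
    and h: "continuous_on {0..T} h"
    and x: "\<And>t. t \<in> {0..T} \<Longrightarrow> x t = x 0 + RL_int \<alpha> h t"
    and V: "convex_on UNIV V" "\<And>z. V differentiable (at z)"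
    and y': "continuous_on {0..T} y'"
    and y: "\<And>t. t \<in> {0..T} \<Longrightarrow> y t = y 0 + integral {0..t} y'"
    and init: "V (x 0) \<le> y 0"
    and dec: "\<And>t. t \<in> {0<..T} \<Longrightarrow> y t < V (x t) \<Longrightarrow> grad V (x t) \<bullet> h t \<le> RL_int (1 - \<alpha>) y' t"
    and t1: "t1 \<in> {0..T}"
  shows "V (x t1) \<le> y t1"
proof (rule ccontr)
  assume "\<not> V (x t1) \<le> y t1"
  then have pos: "0 < V (x t1) - y t1" by simp
  define m where "m = RL_int (1 - \<alpha>) y'"
  have m: "continuous_on {0..T} m" unfolding m_def using \<alpha> y' by (intro continuous_on_RL_int) auto
  \<comment> \<open>The composition rule puts \<open>y\<close> into the same form as
    \<open>x\<close>, a constant plus \<open>RL_int \<alpha>\<close> of a continuous function, as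
    the maximum principle requires.\<close>
  have ym: "y s = y 0 + RL_int \<alpha> m s" if "s \<in> {0..T}" for s
    using y[OF that] that RL_int_RL_int[of \<alpha> "1 - \<alpha>" s y'] \<alpha> continuous_on_subset[OF y', of "{0..s}"]
    by (simp add: m_def)
  have xc: "continuous_on {0..T} x"
    by (subst continuous_on_cong[OF refl x]) (auto intro!: continuous_intros continuous_on_RL_int \<alpha> h)
  have yc: "continuous_on {0..T} y"
    by (subst continuous_on_cong[OF refl ym]) (auto intro!: continuous_intros continuous_on_RL_int \<alpha> m)
  have Vc: "continuous_on UNIV V"
    using V(2) by (meson continuous_at_imp_continuous_on differentiable_imp_continuous_within)
  have "continuous_on {0..T} (\<lambda>s. V (x s) - y s)"
    by (intro continuous_intros yc continuous_on_compose2[OF Vc xc]) auto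
  then have "continuous_on {0..t1} (\<lambda>s. V (x s) - y s)"
    by (rule continuous_on_subset) (use t1 in auto)
  then obtain t where t: "t \<in> {0..t1}"
    and max: "\<And>s. s \<in> {0..t1} \<Longrightarrow> V (x s) - y s \<le> V (x t) - y t"
    using continuous_attains_sup[of "{0..t1}" "\<lambda>s. V (x s) - y s"] t1 by auto
  have gt: "0 < V (x t) - y t" using max[of t1] pos t1 by auto
  then have "t \<noteq> 0" using init by auto
  then have t0: "0 < t" "t \<le> T" using t t1 by auto
  define p where "p = grad V (x t)"
  define q where "q s = p \<bullet> x s - y s" for s
  have tangent: "p \<bullet> (x s - x t) \<le> V (x s) - V (x t)" for s
    using convex_above_tangent_grad[OF V(1,2), of "x t" "x s"] by (simp add: p_def)
  have "(q t - (p \<bullet> x 0 - y 0)) * t powr (- \<alpha>) \<le> Gamma (1 - \<alpha>) * (p \<bullet> h t - m t)"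
  proof (rule RL_int_max_principle[OF \<alpha> t0(1)])
    show "continuous_on {0..t} (\<lambda>s. p \<bullet> h s - m s)"
      using t0 by (intro continuous_intros continuous_on_subset[OF h] continuous_on_subset[OF m]) auto
    fix s assume s: "s \<in> {0..t}"
    have cs: "continuous_on {0..s} h" "continuous_on {0..s} m"
      using s t0 by (auto intro: continuous_on_subset[OF h] continuous_on_subset[OF m])
    have "RL_int \<alpha> (\<lambda>s. p \<bullet> h s - m s) s = p \<bullet> RL_int \<alpha> h s - RL_int \<alpha> m s"
      using cs \<alpha> by (subst RL_int_diff) (auto intro!: continuous_intros simp: RL_int_inner)
    moreover have "q s = p \<bullet> (x 0 + RL_int \<alpha> h s) - (y 0 + RL_int \<alpha> m s)"
      using x[of s] ym[of s] s t0 unfolding q_def by auto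
    ultimately show "q s = p \<bullet> x 0 - y 0 + RL_int \<alpha> (\<lambda>s. p \<bullet> h s - m s) s"
      by (simp add: inner_add_right)
    \<comment> \<open>Replacing \<open>V\<close> by its tangent plane at \<open>x t\<close> keeps
      the value at time \<open>t\<close> up to a constant and lowers it elsewhere, so the maximum
      stays at \<open>t\<close>.\<close>
    show "q s \<le> q t"
      using tangent[of s] max[of s] s t by (auto simp: q_def inner_diff_right)
  qed
  moreover have "p \<bullet> h t \<le> m t" using dec[of t] t0 gt by (simp add: p_def m_def)
  moreover have "Gamma (1 - \<alpha>) > 0" using \<alpha> by (intro Gamma_real_pos) auto
  ultimately have "(q t - (p \<bullet> x 0 - y 0)) * t powr (- \<alpha>) \<le> 0"
    by (elim order_trans) (simp add: mult_le_0_iff)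
  \<comment> \<open>The tangent inequality at \<open>x 0\<close> bounds this from below by
    \<open>(V (x t) - y t) - (V (x 0) - y 0)\<close>.\<close>
  moreover have "0 < q t - (p \<bullet> x 0 - y 0)"
    using tangent[of 0] gt init by (simp add: q_def inner_diff_right)
  ultimately show False
    using t0 by (simp add: mult_le_0_iff)
qed

section \<open>Global solutions of the integral equation\<close>

text \<open>Split at distance \<open>R\<close> from \<open>t\<close>: nearby,
  \<open>w \<le> N\<close> meets the kernel integral \<open>R powr \<beta> / \<beta>\<close>;
  farther away, the kernel is at most \<open>R powr (\<beta> - 1)\<close> and the mass of
  \<open>w\<close> at most \<open>N * R\<close>. Growing and decaying exponentials both fit, with
  \<open>R\<close> the reciprocal of the rate.\<close>

lemma abel_int_le_of_small_mass:
  fixes w :: "real \<Rightarrow> real"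
  assumes \<beta>: "0 < \<beta>" "\<beta> < 1" and t: "0 \<le> t" and R: "0 < R" and w: "continuous_on {0..t} w"
    and w0: "\<And>s. s \<in> {0..t} \<Longrightarrow> 0 \<le> w s" and wN: "\<And>s. s \<in> {0..t} \<Longrightarrow> w s \<le> N"
    and mass: "integral {0..t} w \<le> N * R"
  shows "abel_int \<beta> w t \<le> N * R powr \<beta> * (1 / \<beta> + 1)"
proof -
  have N: "0 \<le> N" using w0[of 0] wN[of 0] t by auto
  have near: "integral {c..t} (\<lambda>s. (t - s) powr (\<beta> - 1) *\<^sub>R w s) \<le> N * (R powr \<beta> / \<beta>)"
    if c: "0 \<le> c" "c \<le> t" "t - c \<le> R" for c
  proof -
    have "norm (integral {c..t} (\<lambda>s. (t - s) powr (\<beta> - 1) *\<^sub>R w s))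
      \<le> N * (((t - c) powr \<beta> - (t - t) powr \<beta>) / \<beta>)"
      using c \<beta> w0 wN
      by (intro norm_integral_weighted_le abel_kernel_has_integral abel_kernel_integrable
          continuous_on_subset[OF w]) auto
    also have "\<dots> \<le> N * (R powr \<beta> / \<beta>)"
      using c \<beta> N by (intro mult_left_mono divide_right_mono) (auto intro!: powr_mono2)
    finally show ?thesis by simp
  qed
  show ?thesis
  proof (cases "t \<le> R")
    case True
    have "abel_int \<beta> w t \<le> N * (R powr \<beta> / \<beta>)"
      unfolding abel_int_def using near[of 0] True t by simp
    moreover have "0 \<le> N * R powr \<beta>" using N by simp
    ultimately show ?thesis by (simp add: algebra_simps)
  next
    case False
    define c where "c = t - R"
    have c: "0 \<le> c" "c \<le> t" "t - c = R" using False R by (auto simp: c_def)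
    have wc: "continuous_on {0..c} w" by (rule continuous_on_subset[OF w]) (use c in auto)
    have "integral {0..c} (\<lambda>s. (t - s) powr (\<beta> - 1) *\<^sub>R w s) \<le> integral {0..c} (\<lambda>s. R powr (\<beta> - 1) * w s)"
    proof (rule integral_le)
      show "(\<lambda>s. (t - s) powr (\<beta> - 1) *\<^sub>R w s) integrable_on {0..c}"
        by (intro abel_kernel_integrable wc \<beta> c)
      show "(\<lambda>s. R powr (\<beta> - 1) * w s) integrable_on {0..c}"
        by (intro integrable_continuous_real continuous_intros wc)
      fix s assume "s \<in> {0..c}"
      then show "(t - s) powr (\<beta> - 1) *\<^sub>R w s \<le> R powr (\<beta> - 1) * w s"
        using c R \<beta> w0[of s] by (auto intro!: mult_right_mono powr_mono2')
    qed
    also have "\<dots> = R powr (\<beta> - 1) * integral {0..c} w" by simp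
    also have "\<dots> \<le> R powr (\<beta> - 1) * (N * R)"
    proof (intro mult_left_mono)
      have "integral {0..c} w \<le> integral {0..t} w"
        using c w w0 by (intro integral_subset_le integrable_continuous_real wc) auto
      then show "integral {0..c} w \<le> N * R" using mass by simp
    qed auto
    also have "\<dots> = N * R powr \<beta>" using R by (simp add: powr_diff)
    finally have "integral {0..c} (\<lambda>s. (t - s) powr (\<beta> - 1) *\<^sub>R w s) \<le> N * R powr \<beta>" .
    then show ?thesis
      using near[of c] c abel_int_split[OF \<beta>(1) c(1,2) w] by (simp add: algebra_simps)
  qed
qed

lemma exp_has_integral:
  fixes \<mu> :: real
  assumes "\<mu> \<noteq> 0" "0 \<le> t"
  shows "((\<lambda>s. exp (\<mu> * s)) has_integral (exp (\<mu> * t) - 1) / \<mu>) {0..t}"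
proof -
  have "((\<lambda>s. exp (\<mu> * s)) has_integral exp (\<mu> * t) / \<mu> - exp (\<mu> * 0) / \<mu>) {0..t}"
    using assms
    by (intro fundamental_theorem_of_calculus)
       (auto intro!: derivative_eq_intros simp flip: has_real_derivative_iff_has_vector_derivative)
  then show ?thesis by (simp add: diff_divide_distrib)
qed

text \<open>The last factor is independent of \<open>t\<close> and tends to \<open>0\<close> as
  \<open>\<mu>\<close> grows. It becomes the contraction factor in the weighted norm on the entire
  half-line.\<close>

lemma norm_RL_int_le_exp:
  fixes k :: "real \<Rightarrow> 'a::euclidean_space"
  assumes \<alpha>: "0 < \<alpha>" "\<alpha> < 1" and t: "0 \<le> t" and \<mu>: "0 < \<mu>" and k: "continuous_on {0..t} k"
    and le: "\<And>s. s \<in> {0..t} \<Longrightarrow> norm (k s) \<le> A * exp (\<mu> * s)" and A: "0 \<le> A"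
  shows "norm (RL_int \<alpha> k t) \<le> A * exp (\<mu> * t) * ((1 / \<mu>) powr \<alpha> * (1 / \<alpha> + 1) / Gamma \<alpha>)"
proof -
  have G: "Gamma \<alpha> > 0" using \<alpha> by (intro Gamma_real_pos) auto
  have ec: "continuous_on {0..t} (\<lambda>s. exp (\<mu> * s))" by (intro continuous_intros)
  have "norm (abel_int \<alpha> k t) \<le> integral {0..t} (\<lambda>s. (t - s) powr (\<alpha> - 1) *\<^sub>R (A *\<^sub>R exp (\<mu> * s)))"
    unfolding abel_int_def
    using \<alpha> k le
    by (intro integral_norm_bound_integral abel_kernel_integrable continuous_intros)
       (auto intro!: mult_left_mono)
  also have "\<dots> = A * abel_int \<alpha> (\<lambda>s. exp (\<mu> * s)) t"
    using abel_int_scaleR[of \<alpha> A "\<lambda>s. exp (\<mu> * s)" t] by (simp add: abel_int_def)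
  also have "\<dots> \<le> A * (exp (\<mu> * t) * (1 / \<mu>) powr \<alpha> * (1 / \<alpha> + 1))"
  proof (intro mult_left_mono A abel_int_le_of_small_mass \<alpha> t ec)
    show "integral {0..t} (\<lambda>s. exp (\<mu> * s)) \<le> exp (\<mu> * t) * (1 / \<mu>)"
      using integral_unique[OF exp_has_integral[of \<mu> t]] \<mu> t by (simp add: field_simps)
  qed (use \<mu> in auto)
  finally have "(1 / Gamma \<alpha>) * norm (abel_int \<alpha> k t) \<le> (1 / Gamma \<alpha>) * (A * (exp (\<mu> * t) * (1 / \<mu>) powr \<alpha> * (1 / \<alpha> + 1)))"
    using G by (intro mult_left_mono) auto
  then show ?thesis using G by (simp add: RL_int_eq_abel_int mult_ac)
qed

text \<open>The unknown is the rescaled function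
  \<open>u t = exp (- \<mu> * t) *\<^sub>R x t\<close>; for it the weighted norm is the plain
  supremum norm of bounded continuous functions.\<close>

lemma RL_int_global_solution:
  fixes g :: "'a::euclidean_space \<Rightarrow> 'a"
  assumes \<alpha>: "0 < \<alpha>" "\<alpha> < 1" and g: "L-lipschitz_on UNIV g" and g0: "g 0 = 0"
  shows "\<exists>x. continuous_on UNIV x \<and> (\<forall>t\<ge>0. x t = x0 + RL_int \<alpha> (\<lambda>s. g (x s)) t)"
proof -
  have L: "0 \<le> L" using g by (rule lipschitz_on_nonneg)
  have G: "Gamma \<alpha> > 0" using \<alpha> by (intro Gamma_real_pos) auto
  have gc: "continuous_on UNIV g" using g by (rule lipschitz_on_continuous_on)
  define E where "E = (1 / \<alpha> + 1) / Gamma \<alpha>"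
  define Q where "Q = 2 * (L + 1) * E"
  \<comment> \<open>Solves \<open>(1 / \<mu>) powr \<alpha> = 1 / Q\<close>, which makes the
    contraction factor \<open>L / (2 * (L + 1))\<close>, at most one half even for
    \<open>L = 0\<close>.\<close>
  define \<mu> where "\<mu> = Q powr (1 / \<alpha>)"
  have "1 / \<alpha> + 1 > 0" using \<alpha> by (auto intro: add_pos_pos)
  then have E: "E > 0" using G by (simp add: E_def)
  then have Q: "Q > 0" using L by (simp add: Q_def)
  then have \<mu>: "\<mu> > 0" by (simp add: \<mu>_def)
  have "(1 / \<mu>) powr \<alpha> = 1 / Q" using \<alpha> Q by (simp add: \<mu>_def powr_divide powr_powr)
  then have "L * ((1 / \<mu>) powr \<alpha> * (1 / \<alpha> + 1) / Gamma \<alpha>) = L * E / Q" by (simp add: E_def)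
  also have "\<dots> = L / (2 * (L + 1))" using E by (simp add: Q_def)
  also have "\<dots> \<le> 1 / 2" using L by (simp add: field_simps)
  finally have \<theta>: "L * ((1 / \<mu>) powr \<alpha> * (1 / \<alpha> + 1) / Gamma \<alpha>) \<le> 1 / 2" .
  define k where "k u s = g (exp (\<mu> * s) *\<^sub>R u s)" for u :: "real \<Rightarrow> 'a" and s
  \<comment> \<open>The Picard operator for \<open>u\<close>. Bounded continuous functions live on
    the whole line, so \<open>max 0 t\<close> extends the image to negative times by its value at
    \<open>0\<close>.\<close>
  define \<Psi> where "\<Psi> u t = exp (- \<mu> * max 0 t) *\<^sub>R (x0 + RL_int \<alpha> (k u) (max 0 t))" for u t
  have kc: "continuous_on S (k u)" if "continuous_on UNIV u" for u S
    unfolding k_def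
    by (intro continuous_on_compose2[OF gc] continuous_intros continuous_on_subset[OF that]) auto
  have contr: "norm (\<Psi> u t - \<Psi> v t) \<le> 1 / 2 * A"
    if uv: "continuous_on UNIV u" "continuous_on UNIV v" "\<And>s. norm (u s - v s) \<le> A" for u v t A
  proof -
    define t' where "t' = max 0 t"
    have A: "0 \<le> A" using order_trans[OF norm_ge_zero uv(3)] .
    have "\<Psi> u t - \<Psi> v t = exp (- \<mu> * t') *\<^sub>R RL_int \<alpha> (\<lambda>s. k u s - k v s) t'"
      using \<alpha> uv by (subst RL_int_diff) (auto simp: \<Psi>_def t'_def kc algebra_simps)
    then have "norm (\<Psi> u t - \<Psi> v t) = exp (- \<mu> * t') * norm (RL_int \<alpha> (\<lambda>s. k u s - k v s) t')"
      by simp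
    also have "\<dots> \<le> exp (- \<mu> * t') * ((L * A) * exp (\<mu> * t') * ((1 / \<mu>) powr \<alpha> * (1 / \<alpha> + 1) / Gamma \<alpha>))"
    proof (intro mult_left_mono norm_RL_int_le_exp \<alpha> \<mu>)
      show "continuous_on {0..t'} (\<lambda>s. k u s - k v s)" by (intro continuous_intros kc uv)
      fix s
      have "norm (k u s - k v s) \<le> L * norm (exp (\<mu> * s) *\<^sub>R u s - exp (\<mu> * s) *\<^sub>R v s)"
        unfolding k_def using lipschitz_on_normD[OF g] by simp
      also have "\<dots> = L * (exp (\<mu> * s) * norm (u s - v s))" by (simp flip: scaleR_diff_right)
      also have "\<dots> \<le> L * (exp (\<mu> * s) * A)" using uv(3) L by (intro mult_left_mono) auto
      finally show "norm (k u s - k v s) \<le> L * A * exp (\<mu> * s)" by (simp add: mult_ac)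
    qed (use L A in \<open>auto simp: t'_def\<close>)
    also have "\<dots> = (L * ((1 / \<mu>) powr \<alpha> * (1 / \<alpha> + 1) / Gamma \<alpha>)) * A"
      by (simp add: mult_ac exp_minus)
    also have "\<dots> \<le> 1 / 2 * A" using \<theta> A by (rule mult_right_mono)
    finally show ?thesis .
  qed
  have bc: "\<Psi> (apply_bcontfun u) \<in> bcontfun" for u :: "real \<Rightarrow>\<^sub>C 'a"
  proof (rule bcontfun_normI)
    have R: "continuous_on {0..} (RL_int \<alpha> (k (apply_bcontfun u)))"
      by (intro continuous_on_atLeast_0I continuous_on_RL_int \<alpha> kc) auto
    show "continuous_on UNIV (\<Psi> (apply_bcontfun u))"
      unfolding \<Psi>_def by (intro continuous_intros continuous_on_compose2[OF R]) auto
    fix t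
    \<comment> \<open>Because \<open>g 0 = 0\<close>, the image of the zero function is bounded
      explicitly, and the contraction estimate transfers boundedness to every other image.\<close>
    have z: "\<Psi> (\<lambda>_. 0) t = exp (- \<mu> * max 0 t) *\<^sub>R x0"
      by (simp add: \<Psi>_def k_def[abs_def] g0 RL_int_def)
    have "norm (\<Psi> u t - \<Psi> (\<lambda>_. 0) t) \<le> 1 / 2 * norm u"
      by (rule contr) (auto simp: norm_bounded)
    moreover have "norm (exp (- \<mu> * max 0 t) *\<^sub>R x0) \<le> 1 * norm x0"
      using \<mu> unfolding norm_scaleR by (intro mult_right_mono) auto
    ultimately show "norm (\<Psi> u t) \<le> norm x0 + 1 / 2 * norm u"
      unfolding z using norm_triangle_ineq2[of "\<Psi> u t" "exp (- \<mu> * max 0 t) *\<^sub>R x0"] by linarith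
  qed
  have "\<exists>!u::real \<Rightarrow>\<^sub>C 'a. Bcontfun (\<Psi> (apply_bcontfun u)) = u"
  proof (rule banach_fix_type[of "1 / 2"])
    show "\<forall>(u::real \<Rightarrow>\<^sub>C 'a) (v::real \<Rightarrow>\<^sub>C 'a). dist (Bcontfun (\<Psi> (apply_bcontfun u))) (Bcontfun (\<Psi> (apply_bcontfun v))) \<le> 1 / 2 * dist u v"
    proof (intro allI dist_bound)
      fix u v :: "real \<Rightarrow>\<^sub>C 'a" and t
      have "norm (\<Psi> u t - \<Psi> v t) \<le> 1 / 2 * dist u v"
        by (rule contr) (use dist_bounded[of u _ v] in \<open>auto simp: dist_norm\<close>)
      then show "dist (Bcontfun (\<Psi> u) t) (Bcontfun (\<Psi> v) t) \<le> 1 / 2 * dist u v"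
        using bc by (simp add: Bcontfun_inverse dist_norm)
    qed
  qed auto
  then obtain u :: "real \<Rightarrow>\<^sub>C 'a" where "Bcontfun (\<Psi> u) = u" by blast
  then have u: "apply_bcontfun u = \<Psi> u" by (metis Bcontfun_inverse bc)
  define x where "x t = exp (\<mu> * t) *\<^sub>R u t" for t
  have "x t = x0 + RL_int \<alpha> (\<lambda>s. g (x s)) t" if "t \<ge> 0" for t
  proof -
    have "x t = exp (\<mu> * t) *\<^sub>R \<Psi> u t" by (simp add: x_def flip: u)
    also have "\<dots> = x0 + RL_int \<alpha> (k u) t"
      using that by (simp add: \<Psi>_def exp_minus scaleR_add_right)
    finally show ?thesis by (simp add: k_def[abs_def] x_def)
  qed
  moreover have "continuous_on UNIV x" unfolding x_def by (intro continuous_intros) auto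
  ultimately show ?thesis by blast
qed

section \<open>Stability\<close>

text \<open>The radius \<open>\<rho>\<close> is one on which a single Lipschitz constant for
  \<open>f\<close> and all bounds on \<open>V\<close> hold together.\<close>

locale frac_lyapunov =
  fixes \<alpha> :: real and f :: "'a::euclidean_space \<Rightarrow> 'a" and V :: "'a \<Rightarrow> real"
    and a b c C1 C2 C3 L \<rho> :: real
  assumes alpha: "0 < \<alpha>" "\<alpha> < 1"
    and f0: "f 0 = 0"
    and f_lip: "L-lipschitz_on (cball 0 \<rho>) f"
    and V_convex: "convex_on UNIV V"
    and V_diff: "\<And>x. V differentiable (at x)"
    and pos: "0 < a" "0 < b" "0 < c" "0 < C1" "0 < C2" "0 < \<rho>"
    and C3: "0 \<le> C3"
    and V_lower: "\<And>x. x \<in> cball 0 \<rho> \<Longrightarrow> C1 * norm x powr a \<le> V x"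
    and V_upper: "\<And>x. x \<in> cball 0 \<rho> \<Longrightarrow> V x \<le> C2 * norm x powr b"
    and V_dec: "\<And>x. x \<in> cball 0 \<rho> \<Longrightarrow> grad V x \<bullet> f x \<le> - C3 * norm x powr c"
begin

section \<open>Confinement to small balls, global existence and stability\<close>

lemma V_nonneg_ball: "x \<in> cball 0 \<rho> \<Longrightarrow> 0 \<le> V x"
  using V_lower[of x] pos order_trans[of 0 "C1 * norm x powr a" "V x"] by simp

lemma continuous_on_f_comp:
  assumes "continuous_on S x" "\<And>s. s \<in> S \<Longrightarrow> norm (x s) \<le> \<rho>"
  shows "continuous_on S (\<lambda>s. f (x s))"
  by (rule continuous_on_compose2[OF lipschitz_on_continuous_on[OF f_lip] assms(1)])
     (use assms(2) in auto)

text \<open>At the first time \<open>t1\<close> with norm \<open>\<epsilon>\<close> the constant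
  barrier gives \<open>V (x t1) \<le> V (x 0)\<close>, while the bounds on \<open>V\<close> give
  \<open>V (x 0) < C1 * \<epsilon> powr a \<le> V (x t1)\<close>. The integral equation is assumed
  only as long as \<open>x\<close> stays in the ball, so that both Caputo solutions and solutions of
  the truncated equation qualify.\<close>

lemma RL_int_norm_less:
  assumes x: "continuous_on {0..T} x" and T: "0 \<le> T" and \<epsilon>: "0 < \<epsilon>" "\<epsilon> \<le> \<rho>"
    and x0: "norm (x 0) < \<epsilon>" "C2 * norm (x 0) powr b < C1 * \<epsilon> powr a"
    and sol: "\<And>t1 t. t1 \<in> {0..T} \<Longrightarrow> (\<And>s. s \<in> {0..t1} \<Longrightarrow> norm (x s) \<le> \<epsilon>) \<Longrightarrow> t \<in> {0..t1} \<Longrightarrow>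
      x t = x 0 + RL_int \<alpha> (\<lambda>s. f (x s)) t"
  shows "norm (x T) < \<epsilon>"
proof (rule ccontr)
  assume "\<not> norm (x T) < \<epsilon>"
  have hit: "\<exists>r\<in>{0..s}. norm (x r) = \<epsilon>" if s: "s \<in> {0..T}" "\<epsilon> \<le> norm (x s)" for s
  proof -
    have "continuous_on {0..s} (\<lambda>r. norm (x r))"
      by (intro continuous_intros continuous_on_subset[OF x]) (use s in auto)
    then show ?thesis
      using IVT'[of "\<lambda>r. norm (x r)" 0 \<epsilon> s] s x0(1) by auto
  qed
  define S where "S = {s \<in> {0..T}. norm (x s) = \<epsilon>}"
  have "compact S"
  proof -
    have "closed S"
      unfolding S_def using continuous_on_norm[OF x]
      by (rule continuous_closed_preimage_constant) simp
    moreover have "S \<subseteq> {0..T}" by (auto simp: S_def)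
    ultimately show ?thesis by (meson bounded_closed_interval bounded_subset compact_eq_bounded_closed)
  qed
  moreover have "S \<noteq> {}" using hit[of T] T \<open>\<not> norm (x T) < \<epsilon>\<close> by (auto simp: S_def)
  ultimately obtain t1 where t1: "t1 \<in> S" and first: "\<And>s. s \<in> S \<Longrightarrow> t1 \<le> s"
    using compact_attains_inf[of S] by blast
  have t1': "t1 \<in> {0..T}" "norm (x t1) = \<epsilon>" using t1 by (auto simp: S_def)
  have before: "norm (x s) \<le> \<epsilon>" if "s \<in> {0..t1}" for s
  proof (rule ccontr)
    assume "\<not> norm (x s) \<le> \<epsilon>"
    then have gt: "\<epsilon> < norm (x s)" by simp
    moreover have "s \<in> {0..T}" using that t1' by auto
    ultimately obtain r where "r \<in> {0..s}" "norm (x r) = \<epsilon>" using hit[of s] by fastforce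
    then have "r \<in> S" "r \<le> s" using that t1' by (auto simp: S_def)
    then have "r = t1" "s = t1" using first[of r] that by auto
    then show False using gt t1' by simp
  qed
  have xc: "continuous_on {0..t1} x" by (rule continuous_on_subset[OF x]) (use t1' in auto)
  have "V (x t1) \<le> V (x 0)"
  proof (rule lyapunov_comparison[OF alpha, where h = "\<lambda>s. f (x s)" and x = x and V = V
        and y = "\<lambda>_. V (x 0)" and y' = "\<lambda>_. 0" and T = t1])
    show "continuous_on {0..t1} (\<lambda>s. f (x s))"
      using before \<epsilon> by (intro continuous_on_f_comp xc) force
    show "grad V (x t) \<bullet> f (x t) \<le> RL_int (1 - \<alpha>) (\<lambda>_. 0) t" if t: "t \<in> {0<..t1}" for t
    proof -
      have "x t \<in> cball 0 \<rho>" using before[of t] t \<epsilon> by simp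
      then have "grad V (x t) \<bullet> f (x t) \<le> - C3 * norm (x t) powr c" by (rule V_dec)
      also have "\<dots> \<le> 0" using C3 by simp
      finally show ?thesis by (simp add: RL_int_def)
    qed
    show "x t = x 0 + RL_int \<alpha> (\<lambda>s. f (x s)) t" if "t \<in> {0..t1}" for t
      by (rule sol[OF t1'(1) before that])
  qed (use V_convex V_diff t1' in auto)
  also have "V (x 0) \<le> C2 * norm (x 0) powr b" using x0 \<epsilon> by (intro V_upper) auto
  also note x0(2)
  also have "C1 * \<epsilon> powr a \<le> V (x t1)" using V_lower[of "x t1"] t1' \<epsilon> by simp
  finally show False by simp
qed

text \<open>The bound by \<open>\<rho>\<close> keeps \<open>x\<close> where \<open>f\<close> is
  Lipschitz, which supplies the continuous right-hand side needed to invert the Caputo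
  derivative.\<close>

lemma solution_RL_int:
  assumes sol: "is_solution \<alpha> D f T x" and t1: "ereal t1 < T"
    and le: "\<And>s. s \<in> {0..t1} \<Longrightarrow> norm (x s) \<le> \<rho>" and t: "t \<in> {0..t1}"
  shows "x t = x 0 + RL_int \<alpha> (\<lambda>s. f (x s)) t"
proof (rule caputo_imp_RL_int[OF alpha _ _ _ t])
  have lt: "ereal s < T" if "s \<le> t1" for s by (rule le_less_trans[OF _ t1]) (use that in simp)
  show xc: "continuous_on {0..t1} x"
  proof (rule continuous_on_subset)
    show "continuous_on {t. 0 \<le> t \<and> ereal t < T} x" using sol by (simp add: is_solution_def)
  qed (use lt in auto)
  show "continuous_on {0..t1} (\<lambda>s. f (x s))"
    using xc le by (rule continuous_on_f_comp)
  fix r assume "0 < r" "r < t1"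
  then have "(\<lambda>s. RL_int (1 - \<alpha>) (\<lambda>\<tau>. x \<tau> - x 0) s) differentiable (at r)" "caputo \<alpha> x r = f (x r)"
    using sol lt[of r] unfolding is_solution_def by auto
  then show "((\<lambda>s. RL_int (1 - \<alpha>) (\<lambda>\<tau>. x \<tau> - x 0) s) has_vector_derivative f (x r)) (at r)"
    by (simp add: vector_derivative_works caputo_def)
qed

lemma solution_norm_less:
  assumes sol: "is_solution \<alpha> D f T x" and \<epsilon>: "0 < \<epsilon>" "\<epsilon> \<le> \<rho>"
    and x0: "norm (x 0) < \<epsilon>" "C2 * norm (x 0) powr b < C1 * \<epsilon> powr a"
    and t: "0 \<le> t" "ereal t < T"
  shows "norm (x t) < \<epsilon>"
proof (rule RL_int_norm_less[where x = x, OF _ t(1) \<epsilon> x0])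
  have lt: "ereal s < T" if "s \<le> t" for s by (rule le_less_trans[OF _ t(2)]) (use that in simp)
  show "continuous_on {0..t} x"
  proof (rule continuous_on_subset)
    show "continuous_on {t. 0 \<le> t \<and> ereal t < T} x" using sol by (simp add: is_solution_def)
  qed (use lt in auto)
  fix t1 s assume t1: "t1 \<in> {0..t}" and le: "\<And>s. s \<in> {0..t1} \<Longrightarrow> norm (x s) \<le> \<epsilon>" and s: "s \<in> {0..t1}"
  show "x s = x 0 + RL_int \<alpha> (\<lambda>s. f (x s)) s"
    by (rule solution_RL_int[OF sol lt order_trans[OF le \<epsilon>(2)] s]) (use t1 in auto)
qed

text \<open>The nearest-point projection has Lipschitz constant \<open>1\<close>, so
  \<open>g\<close> is globally Lipschitz with the constant \<open>L\<close>. Its solution never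
  leaves the open ball of radius \<open>\<rho>\<close>, where \<open>g\<close> and \<open>f\<close>
  agree.\<close>

lemma global_solution_exists:
  assumes D: "cball 0 \<rho> \<subseteq> D" and x0: "norm x0 < \<rho>" "C2 * norm x0 powr b < C1 * \<rho> powr a"
  shows "\<exists>x. is_solution \<alpha> D f \<infinity> x \<and> x 0 = x0"
proof -
  let ?P = "closest_point (cball (0::'a) \<rho>)"
  define g where "g z = f (?P z)" for z
  have B: "convex (cball (0::'a) \<rho>)" "closed (cball (0::'a) \<rho>)" "cball (0::'a) \<rho> \<noteq> {}"
    using pos by auto
  have P: "?P z \<in> cball 0 \<rho>" for z using B by (intro closest_point_in_set) auto
  have P_id: "?P z = z" if "norm z \<le> \<rho>" for z using that by (intro closest_point_self) simp
  have L: "0 \<le> L" using f_lip by (rule lipschitz_on_nonneg)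
  have "L-lipschitz_on UNIV g"
  proof (rule lipschitz_onI[OF _ L])
    fix y z :: 'a
    have "dist (g y) (g z) \<le> L * dist (?P y) (?P z)"
      unfolding g_def using P by (intro lipschitz_onD[OF f_lip])
    also have "\<dots> \<le> L * dist y z" using closest_point_lipschitz[OF B] L by (intro mult_left_mono)
    finally show "dist (g y) (g z) \<le> L * dist y z" .
  qed
  moreover have "g 0 = 0" using pos f0 P_id[of 0] by (simp add: g_def)
  ultimately obtain x where xc: "continuous_on UNIV x"
    and x: "\<And>t. 0 \<le> t \<Longrightarrow> x t = x0 + RL_int \<alpha> (\<lambda>s. g (x s)) t"
    using RL_int_global_solution[OF alpha, of L g x0] by blast
  have x_init: "x 0 = x0" using x[of 0] by simp
  have small: "norm (x t) < \<rho>" if "0 \<le> t" for t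
  proof (rule RL_int_norm_less[where x = x, OF _ that pos(6) order_refl])
    fix t1 s assume "\<And>s. s \<in> {0..t1} \<Longrightarrow> norm (x s) \<le> \<rho>" "s \<in> {0..t1}"
    then have "RL_int \<alpha> (\<lambda>s. g (x s)) s = RL_int \<alpha> (\<lambda>s. f (x s)) s"
      by (intro RL_int_cong) (auto simp: g_def P_id)
    then show "x s = x 0 + RL_int \<alpha> (\<lambda>s. f (x s)) s" using x[of s] x_init \<open>s \<in> {0..t1}\<close> by simp
  qed (use x0 x_init continuous_on_subset[OF xc] in auto)
  have fc: "continuous_on {0..} (\<lambda>s. f (x s))"
    using small by (intro continuous_on_f_comp continuous_on_subset[OF xc]) (auto intro: less_imp_le)
  have xf: "x t = x0 + RL_int \<alpha> (\<lambda>s. f (x s)) t" if "0 \<le> t" for t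
  proof -
    have "RL_int \<alpha> (\<lambda>s. g (x s)) t = RL_int \<alpha> (\<lambda>s. f (x s)) t"
      using small by (intro RL_int_cong) (simp add: g_def P_id less_imp_le)
    then show ?thesis using x[OF that] by simp
  qed
  have "is_solution \<alpha> D f \<infinity> x"
    unfolding is_solution_def
  proof (intro conjI allI impI)
    show "continuous_on {t. 0 \<le> t \<and> ereal t < \<infinity>} x" by (rule continuous_on_subset[OF xc]) simp
    fix t :: real
    show "x t \<in> D" if "0 \<le> t \<and> ereal t < \<infinity>"
      using small[of t] that D by (auto simp: less_imp_le)
    assume "0 < t \<and> ereal t < \<infinity>"
    then have *: "((\<lambda>s. RL_int (1 - \<alpha>) (\<lambda>\<tau>. x \<tau> - x 0) s) has_vector_derivative f (x t)) (at t)"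
      by (intro RL_int_imp_caputo[OF alpha fc xf]) auto
    then show "(\<lambda>s. RL_int (1 - \<alpha>) (\<lambda>\<tau>. x \<tau> - x 0) s) differentiable (at t)"
      by (rule differentiableI_vector)
    show "caputo \<alpha> x t = f (x t)" unfolding caputo_def using * by (rule vector_derivative_at)
  qed
  then show ?thesis using x_init by blast
qed

lemma initial_radius:
  assumes "0 < \<epsilon>"
  obtains \<delta> where "0 < \<delta>" "\<delta> \<le> \<epsilon>" "\<And>z::'a. norm z < \<delta> \<Longrightarrow> C2 * norm z powr b < C1 * \<epsilon> powr a"
proof
  \<comment> \<open>The second entry is the norm at which \<open>C2 * norm z powr b\<close> reaches
    \<open>C1 * \<epsilon> powr a\<close>.\<close>
  define \<delta> where "\<delta> = min \<epsilon> ((C1 * \<epsilon> powr a / C2) powr (1 / b))"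
  show "0 < \<delta>" "\<delta> \<le> \<epsilon>" using assms pos by (auto simp: \<delta>_def)
  fix z :: 'a assume z: "norm z < \<delta>"
  then have "norm z powr b < ((C1 * \<epsilon> powr a / C2) powr (1 / b)) powr b"
    using pos by (intro powr_less_mono2) (auto simp: \<delta>_def)
  also have "\<dots> = C1 * \<epsilon> powr a / C2" using pos assms by (simp add: powr_powr)
  finally show "C2 * norm z powr b < C1 * \<epsilon> powr a" using pos by (simp add: field_simps)
qed

lemma stable:
  assumes D: "cball 0 \<rho> \<subseteq> D"
  shows "frac_stable \<alpha> D f"
  unfolding frac_stable_def
proof (intro allI impI)
  fix \<epsilon> :: real assume \<epsilon>: "\<epsilon> > 0"
  define \<epsilon>' where "\<epsilon>' = min \<epsilon> \<rho>"
  have \<epsilon>': "0 < \<epsilon>'" "\<epsilon>' \<le> \<epsilon>" "\<epsilon>' \<le> \<rho>" using \<epsilon> pos by (auto simp: \<epsilon>'_def)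
  obtain \<delta> where \<delta>: "0 < \<delta>" "\<delta> \<le> \<epsilon>'" "\<And>z::'a. norm z < \<delta> \<Longrightarrow> C2 * norm z powr b < C1 * \<epsilon>' powr a"
    using initial_radius[OF \<epsilon>'(1)] by blast
  \<comment> \<open>Existence is stated for the radius \<open>\<rho>\<close>; the smallness
    condition for \<open>\<epsilon>'\<close> implies the one for \<open>\<rho>\<close>.\<close>
  have le: "C1 * \<epsilon>' powr a \<le> C1 * \<rho> powr a"
    using \<epsilon>' pos by (intro mult_left_mono powr_mono2) auto
  show "\<exists>\<delta>>0. \<forall>x0. norm x0 < \<delta> \<longrightarrow>
        (\<exists>x. is_solution \<alpha> D f \<infinity> x \<and> x 0 = x0) \<and>
        (\<forall>T x. is_solution \<alpha> D f T x \<and> x 0 = x0 \<longrightarrow> (\<forall>t. 0 \<le> t \<and> ereal t < T \<longrightarrow> norm (x t) < \<epsilon>))"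
  proof (intro exI[of _ \<delta>] conjI allI impI)
    fix x0 :: 'a assume x0: "norm x0 < \<delta>"
    show "\<exists>x. is_solution \<alpha> D f \<infinity> x \<and> x 0 = x0"
      using x0 \<delta>(2) \<delta>(3)[OF x0] \<epsilon>' le by (intro global_solution_exists D) auto
    fix T x t assume "is_solution \<alpha> D f T x \<and> x 0 = x0" "0 \<le> t \<and> ereal t < T"
    then have "norm (x t) < \<epsilon>'"
      using x0 \<delta>(2) \<delta>(3)[OF x0] \<epsilon>' by - (rule solution_norm_less[of D T x], auto)
    then show "norm (x t) < \<epsilon>" using \<epsilon>' by simp
  qed (rule \<delta>(1))
qed

section \<open>Exponential barriers and convergence to the origin for positive
  \<open>C3\<close>\<close>

lemma V_slow_decay:
  assumes C3': "0 < C3" and e: "0 < e"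
    and xc: "continuous_on {0..} x" and le: "\<And>t. 0 \<le> t \<Longrightarrow> norm (x t) \<le> \<rho>"
    and x: "\<And>t. 0 \<le> t \<Longrightarrow> x t = x 0 + RL_int \<alpha> (\<lambda>s. f (x s)) t"
  shows "\<exists>\<eta>>0. \<forall>t\<ge>0. V (x t) \<le> e + V (x 0) * exp (- \<eta> * t)"
proof -
  \<comment> \<open>Where \<open>V z\<close> exceeds \<open>e\<close>, the upper bound gives
    \<open>norm z powr b \<ge> e / C2\<close>; raising this to the power \<open>c / b\<close> shows
    that the dissipation \<open>C3 * norm z powr c\<close> is at least
    \<open>\<kappa>\<close>.\<close>
  define \<kappa> where "\<kappa> = C3 * (e / C2) powr (c / b)"
  have \<kappa>: "0 < \<kappa>" using C3' e pos by (simp add: \<kappa>_def)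
  define v where "v = V (x 0)"
  have v: "0 \<le> v" unfolding v_def using le[of 0] by (intro V_nonneg_ball) simp
  have G: "Gamma (1 - \<alpha>) > 0" using alpha by (intro Gamma_real_pos) auto
  define B where "B = (1 / (1 - \<alpha>) + 1) / Gamma (1 - \<alpha>)"
  have "1 / (1 - \<alpha>) + 1 > 0" using alpha by (intro add_pos_pos) auto
  then have B: "0 < B" using G by (simp add: B_def)
  \<comment> \<open>The barrier has Caputo derivative at least
    \<open>- v * B * \<eta> powr \<alpha>\<close>, and this choice turns
    \<open>v * B * \<eta> powr \<alpha>\<close> into \<open>\<kappa> * (v / (v + 1))\<close>. The
    \<open>1\<close> avoids division by zero when \<open>v = 0\<close>.\<close>
  define \<eta> where "\<eta> = (\<kappa> / ((v + 1) * B)) powr (1 / \<alpha>)"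
  have \<eta>: "0 < \<eta>" using \<kappa> v B by (simp add: \<eta>_def)
  have \<eta>\<alpha>: "\<eta> powr \<alpha> = \<kappa> / ((v + 1) * B)" using \<kappa> v B alpha by (simp add: \<eta>_def powr_powr)
  define y' where "y' s = - (v * \<eta>) * exp (- \<eta> * s)" for s
  have RL: "- \<kappa> \<le> RL_int (1 - \<alpha>) y' t" if t: "0 \<le> t" for t
  proof -
    \<comment> \<open>The decaying exponential is at most \<open>1\<close> and its mass at most
      \<open>1 / \<eta>\<close>, hence \<open>N = 1\<close> and
      \<open>R = 1 / \<eta>\<close>.\<close>
    have "abel_int (1 - \<alpha>) (\<lambda>s. exp (- \<eta> * s)) t \<le> 1 * (1 / \<eta>) powr (1 - \<alpha>) * (1 / (1 - \<alpha>) + 1)"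
    proof (rule abel_int_le_of_small_mass)
      show "integral {0..t} (\<lambda>s. exp (- \<eta> * s)) \<le> 1 * (1 / \<eta>)"
      proof -
        have "integral {0..t} (\<lambda>s. exp (- \<eta> * s)) = (1 - exp (- \<eta> * t)) / \<eta>"
          using integral_unique[OF exp_has_integral[of "- \<eta>" t]] \<eta> t
          by (simp add: diff_divide_distrib)
        also have "\<dots> \<le> 1 / \<eta>" using \<eta> by (intro divide_right_mono) auto
        finally show ?thesis by simp
      qed
    qed (use alpha t \<eta> in \<open>auto intro!: continuous_intros\<close>)
    then have "(v * \<eta>) / Gamma (1 - \<alpha>) * abel_int (1 - \<alpha>) (\<lambda>s. exp (- \<eta> * s)) t
      \<le> (v * \<eta>) / Gamma (1 - \<alpha>) * (1 * (1 / \<eta>) powr (1 - \<alpha>) * (1 / (1 - \<alpha>) + 1))"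
      using v \<eta> G by (intro mult_left_mono) auto
    also have "\<dots> = v * B * (\<eta> * (1 / \<eta>) powr (1 - \<alpha>))" by (simp add: B_def)
    also have "\<eta> * (1 / \<eta>) powr (1 - \<alpha>) = \<eta> powr \<alpha>"
      using \<eta> by (simp add: powr_divide powr_diff)
    also have "v * B * \<eta> powr \<alpha> = \<kappa> * (v / (v + 1))" using B v by (simp add: \<eta>\<alpha>)
    also have "\<dots> \<le> \<kappa> * 1" using \<kappa> v by (intro mult_left_mono) auto
    finally have "(v * \<eta>) / Gamma (1 - \<alpha>) * abel_int (1 - \<alpha>) (\<lambda>s. exp (- \<eta> * s)) t \<le> \<kappa>" by simp
    moreover have "RL_int (1 - \<alpha>) y' t = - ((v * \<eta>) / Gamma (1 - \<alpha>) * abel_int (1 - \<alpha>) (\<lambda>s. exp (- \<eta> * s)) t)"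
      using abel_int_scaleR[of "1 - \<alpha>" "- (v * \<eta>)" "\<lambda>s. exp (- \<eta> * s)" t]
      by (simp add: RL_int_eq_abel_int y'_def[abs_def])
    ultimately show ?thesis by simp
  qed
  have "V (x t) \<le> e + v * exp (- \<eta> * t)" if t: "0 \<le> t" for t
  proof (rule lyapunov_comparison[OF alpha, where h = "\<lambda>s. f (x s)" and x = x and V = V
        and y = "\<lambda>s. e + v * exp (- \<eta> * s)" and y' = y' and T = t])
    show "continuous_on {0..t} (\<lambda>s. f (x s))"
      using le by (intro continuous_on_f_comp continuous_on_subset[OF xc]) auto
    show "continuous_on {0..t} y'" unfolding y'_def by (intro continuous_intros)
    show "V (x 0) \<le> e + v * exp (- \<eta> * 0)" using e by (simp add: v_def)
    fix s assume s: "s \<in> {0..t}"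
    then have "(y' has_integral - (v * \<eta>) * ((exp (- \<eta> * s) - 1) / (- \<eta>))) {0..s}"
      unfolding y'_def using \<eta> by (intro has_integral_mult_right exp_has_integral) auto
    then have "integral {0..s} y' = v * (exp (- \<eta> * s) - 1)"
      using \<eta> by (simp add: integral_unique)
    then show "e + v * exp (- \<eta> * s) = e + v * exp (- \<eta> * 0) + integral {0..s} y'"
      by (simp add: algebra_simps)
  next
    fix s assume s: "s \<in> {0<..t}" and gt: "e + v * exp (- \<eta> * s) < V (x s)"
    have in_ball: "x s \<in> cball 0 \<rho>" using le[of s] s by simp
    have "e < V (x s)" using gt mult_nonneg_nonneg[OF v exp_ge_zero[of "- \<eta> * s"]] by linarith
    also have "\<dots> \<le> C2 * norm (x s) powr b" using in_ball by (rule V_upper)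
    finally have "e / C2 \<le> norm (x s) powr b" using pos by (simp add: field_simps)
    then have "(e / C2) powr (c / b) \<le> (norm (x s) powr b) powr (c / b)"
      using e pos by (intro powr_mono2) auto
    also have "\<dots> = norm (x s) powr c" using pos by (simp add: powr_powr)
    finally have "\<kappa> \<le> C3 * norm (x s) powr c" using C3 unfolding \<kappa>_def by (intro mult_left_mono)
    then show "grad V (x s) \<bullet> f (x s) \<le> RL_int (1 - \<alpha>) y' s"
      using V_dec[OF in_ball] RL[of s] s by simp
  next
    show "x s = x 0 + RL_int \<alpha> (\<lambda>s. f (x s)) s" if "s \<in> {0..t}" for s
      using that by (intro x) auto
  qed (use V_convex V_diff t in auto)
  then show ?thesis using \<eta> by (auto simp: v_def)
qed

text \<open>Half of the level \<open>C1 * d powr a\<close> goes into the constant \<open>e\<close>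
  of the barrier, and the exponential term eventually falls below the other half. The rate
  \<open>\<eta>\<close> depends on \<open>d\<close>, so only convergence results, without a uniform
  rate.\<close>

lemma RL_int_tendsto_0:
  assumes C3': "0 < C3"
    and xc: "continuous_on {0..} x" and le: "\<And>t. 0 \<le> t \<Longrightarrow> norm (x t) \<le> \<rho>"
    and x: "\<And>t. 0 \<le> t \<Longrightarrow> x t = x 0 + RL_int \<alpha> (\<lambda>s. f (x s)) t"
  shows "(x \<longlongrightarrow> 0) at_top"
proof (rule tendstoI)
  fix d :: real assume d: "0 < d"
  define e where "e = C1 * d powr a / 2"
  have e: "0 < e" using d pos by (simp add: e_def)
  obtain \<eta> where \<eta>: "\<eta> > 0" "\<And>t. 0 \<le> t \<Longrightarrow> V (x t) \<le> e + V (x 0) * exp (- \<eta> * t)"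
    using V_slow_decay[OF C3' e xc le x] by blast
  have "((\<lambda>t. exp (- \<eta> * t)) \<longlongrightarrow> 0) at_top"
  proof (rule filterlim_compose[OF exp_at_bot])
    show "filterlim (\<lambda>t. - \<eta> * t) at_bot at_top"
      by (rule filterlim_tendsto_neg_mult_at_bot[OF tendsto_const _ filterlim_ident]) (use \<eta> in simp)
  qed
  then have "((\<lambda>t. e + V (x 0) * exp (- \<eta> * t)) \<longlongrightarrow> e + V (x 0) * 0) at_top"
    by (intro tendsto_intros)
  then have "eventually (\<lambda>t. e + V (x 0) * exp (- \<eta> * t) < C1 * d powr a) at_top"
    by (rule order_tendstoD) (use e in \<open>simp add: e_def\<close>)
  then show "eventually (\<lambda>t. dist (x t) 0 < d) at_top"
    using eventually_ge_at_top[of 0]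
  proof eventually_elim
    case (elim t)
    have "C1 * norm (x t) powr a \<le> V (x t)" using le[of t] elim by (intro V_lower) simp
    also have "\<dots> < C1 * d powr a" using \<eta>(2)[of t] elim by simp
    finally have "norm (x t) powr a < d powr a" using pos by simp
    then have "\<not> d \<le> norm (x t)" using d pos powr_mono2[of a d "norm (x t)"] by auto
    then show ?case by simp
  qed
qed

lemma asymp_stable:
  assumes D: "cball 0 \<rho> \<subseteq> D" and C3': "0 < C3"
  shows "frac_asymp_stable \<alpha> D f"
  unfolding frac_asymp_stable_def
proof (intro conjI stable[OF D])
  obtain \<delta> where \<delta>: "0 < \<delta>" "\<delta> \<le> \<rho>" "\<And>z::'a. norm z < \<delta> \<Longrightarrow> C2 * norm z powr b < C1 * \<rho> powr a"
    using initial_radius[OF pos(6)] by blast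
  show "\<exists>\<delta>>0. \<forall>x0. norm x0 < \<delta> \<longrightarrow>
        (\<exists>x. is_solution \<alpha> D f \<infinity> x \<and> x 0 = x0) \<and>
        (\<forall>x. is_solution \<alpha> D f \<infinity> x \<and> x 0 = x0 \<longrightarrow> (x \<longlongrightarrow> 0) at_top)"
  proof (intro exI[of _ \<delta>] conjI allI impI)
    fix x0 :: 'a assume x0: "norm x0 < \<delta>"
    show "\<exists>x. is_solution \<alpha> D f \<infinity> x \<and> x 0 = x0"
      using x0 \<delta>(2) \<delta>(3)[OF x0] by (intro global_solution_exists D) auto
    fix x assume "is_solution \<alpha> D f \<infinity> x \<and> x 0 = x0"
    then have sol: "is_solution \<alpha> D f \<infinity> x" and x_init: "x 0 = x0" by auto
    have le: "norm (x t) \<le> \<rho>" if "0 \<le> t" for t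
      using x0 \<delta>(2) \<delta>(3)[OF x0] x_init that pos
      by (intro less_imp_le[OF solution_norm_less[OF sol]]) auto
    show "(x \<longlongrightarrow> 0) at_top"
    proof (rule RL_int_tendsto_0[OF C3'])
      show "continuous_on {0..} x"
        using sol unfolding is_solution_def by (auto simp: atLeast_def)
      show "norm (x t) \<le> \<rho>" if "0 \<le> t" for t using that by (rule le)
      show "x t = x 0 + RL_int \<alpha> (\<lambda>s. f (x s)) t" if "0 \<le> t" for t
        by (rule solution_RL_int[OF sol, of t]) (use le that in auto)
    qed
  qed (rule \<delta>(1))
qed

end

theorem theorem4:
  fixes \<alpha> :: real and D :: "'a::euclidean_space set" and f :: "'a \<Rightarrow> 'a"
    and V :: "'a \<Rightarrow> real" and a b c C1 C2 C3 r :: real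
  assumes alpha: "0 < \<alpha>" "\<alpha> < 1"
    and D: "open D" "0 \<in> D"
    and f0: "f 0 = 0"
    and f_lip: "\<exists>U. open U \<and> 0 \<in> U \<and> U \<subseteq> D \<and>
                  (\<forall>y\<in>U. \<exists>e>0. \<exists>L. L-lipschitz_on (ball y e \<inter> U) f)"
    and V_nonneg: "\<And>x. V x \<ge> 0"
    and V_convex: "convex_on UNIV V"
    and V_diff: "\<And>x. V differentiable (at x)"
    and pos: "a > 0" "b > 0" "C1 > 0" "C2 > 0" "r > 0"
    and ball_D: "cball 0 r \<subseteq> D"
    and V_bounds: "\<And>x. x \<in> cball 0 r \<Longrightarrow> C1 * norm x powr a \<le> V x \<and> V x \<le> C2 * norm x powr b"
    and C3: "C3 \<ge> 0" and cb: "c \<ge> b"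
    and V_dec: "\<And>x. x \<in> cball 0 r \<Longrightarrow> inner (grad V x) (f x) \<le> - C3 * norm x powr c"
  shows "(C3 = 0 \<longrightarrow> frac_stable \<alpha> D f) \<and> (C3 > 0 \<longrightarrow> frac_asymp_stable \<alpha> D f)"
proof -
  \<comment> \<open>Local Lipschitz continuity is used at the origin, with \<open>e\<close> and
    \<open>L\<close> taken for \<open>y = 0\<close>.\<close>
  obtain U e L where U: "open U" "0 \<in> U" and e: "e > 0" and L: "L-lipschitz_on (ball 0 e \<inter> U) f"
    using f_lip by blast
  have "open (ball 0 e \<inter> U)" "0 \<in> ball 0 e \<inter> U" using U e by auto
  then obtain \<rho>' where \<rho>': "\<rho>' > 0" "cball 0 \<rho>' \<subseteq> ball 0 e \<inter> U"
    using open_contains_cball by blast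
  \<comment> \<open>Small enough both for the Lipschitz estimate and for the bounds on
    \<open>V\<close>, which hold up to \<open>r\<close>.\<close>
  define \<rho> where "\<rho> = min \<rho>' r"
  have \<rho>: "0 < \<rho>" "cball 0 \<rho> \<subseteq> ball 0 e \<inter> U" "cball 0 \<rho> \<subseteq> cball (0::'a) r"
    using \<rho>' pos by (auto simp: \<rho>_def)
  interpret frac_lyapunov \<alpha> f V a b c C1 C2 C3 L \<rho>
    using alpha f0 V_convex V_diff pos \<rho> C3 cb V_bounds V_dec lipschitz_on_subset[OF L \<rho>(2)]
    by unfold_locales auto
  have "cball 0 \<rho> \<subseteq> D" using \<rho> ball_D by blast
  then show ?thesis using stable asymp_stable by blast
qed

end
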